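(* For $\nu\in\mathbb N$, let $f,f_\nu\in\mathscr F^n$; $g,g_\nu\in C^0(\overline I\times\mathbb R^n\times\mathbb R;\mathbb R)$; $u_o,u_o^\nu\in L^\infty(\mathbb R^n;\mathbb R)$; $u_\infty,u^\nu\in L^\infty(I\times\mathbb R^n;\mathbb R)$; $E,E_\nu\in C^1(\mathbb R;\mathbb R)$. Assume that, as $\nu\to+\infty$: - $f_\nu\to f$ in $\mathscr F^n$ with respect to the seminorms $p_K$; - $g_\nu\to g$ uniformly on compact subsets of $I\times\mathbb R^n\times\mathbb R$; - $u_o^\nu\to u_o$ pointwise a.e. in $\mathbb R^n$ and $(u_o^\nu)_\nu$ is bounded in $L^\infty_{loc}(\mathbb R^n;\mathbb R)$; - $u^\nu\to u_\infty$ pointwise a.e. in $I\times\mathbb R^n$ and $(u^\nu)_\nu$ is bounded in $L^\infty_{loc}(I\times\mathbb R^n;\mathbb R)$; - $E_\nu\to E$ in $C^1(\mathbb R;\mathbb R)$. Let $\mathcal M_{u_\infty}$ be the entropy production functional defined by $f$, $g$, $u_o$ and the function $u_\infty$, and let $\mathcal M_\nu$ be the entropy production functional defined by $f_\nu$, $g_\nu$, $u_o^\nu$ and the function $u^\nu$. Then $\mathcal M_\nu(E_\nu)\to\mathcal M_{u_\infty}(E)$ as $\nu\to+\infty$ in the weak* topology of $\mathcal D'(I\times\mathbb R^n;\mathbb R)$.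
   Context: Let $n\ge1$ be an integer and let $I=[0,+\infty)$ or $I=[0,T)$ for some $T>0$, with closure $\overline I$. $\nabla_x$ and $\operatorname{div}_x$ denote derivatives with respect to $x$ only, with $t$ and $u$ fixed; e.g. $(\operatorname{div}_xF)(t,x,u(t,x))$ is the partial divergence evaluated at $(t,x,u(t,x))$. $\mathcal D(I\times\mathbb R^n;\mathbb R)=C_c^\infty(I\times\mathbb R^n;\mathbb R)$, where compact support means that the support is a compact subset of $I\times\mathbb R^n$ (so $\varphi(0,\cdot)$ need not vanish), and $\mathcal D'(I\times\mathbb R^n;\mathbb R)$ is the corresponding space of distributions. $\mathscr F$ is the set of $\zeta\in C^1(\overline I\times\mathbb R^n\times\mathbb R;\mathbb R)$, with variables $(t,x,u)$, such that $\partial^2_{tu}\zeta$ and $\nabla_x\partial_u\zeta$ are continuous on $\overline I\times\mathbb R^n\times\mathbb R$; $\mathscr F^n$ is the analogous space of $\mathbb R^n$-valued functions. For compact $K\subset I\times\mathbb R^n\times\mathbb R$, $p_K(\zeta)=\|\zeta\|_{C^1(K)}+\|\partial^2_{tu}\zeta\|_{C^0(K)}+\|\nabla_x\partial_u\zeta\|_{C^0(K)}$. Convergence in $C^1(\mathbb R;\mathbb R)$ means uniform convergence of functions and first derivatives on every compact subset of $\mathbb R$. Boundedness in $L^\infty_{loc}$ means boundedness in $L^\infty$ on every compact subset. Entropy production. Given $f\in\mathscr F^n$, $g\in C^0(\overline I\times\mathbb R^n\times\mathbb R;\mathbb R)$, $u_o\in L^\infty(\mathbb R^n;\mathbb R)$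 and $u\in L^\infty(I\times\mathbb R^n;\mathbb R)$ (no equation is required of $u$), for $E\in C^1(\mathbb R;\mathbb R)$ let $F\in\mathscr F^n$ be any function with $\partial_uF(t,x,u)=E'(u)\,\partial_uf(t,x,u)$ (an entropy flux; e.g. $F(t,x,u)=\int_0^uE'(w)\partial_uf(t,x,w)\,dw$; the definition does not depend on the choice). Then $\mathcal M_u(E)\in\mathcal D'(I\times\mathbb R^n;\mathbb R)$ is $$(\mathcal M_u(E))(\varphi)=\int_I\int_{\mathbb R^n}\big(E(u)\,\partial_t\varphi+F(t,x,u)\cdot\nabla_x\varphi\big)dx\,dt-\int_I\int_{\mathbb R^n}E'(u)\,(\operatorname{div}_xf)(t,x,u)\,\varphi\,dx\,dt$$ $$+\int_I\int_{\mathbb R^n}(\operatorname{div}_xF)(t,x,u)\,\varphi\,dx\,dt+\int_I\int_{\mathbb R^n}E'(u)\,g(t,x,u)\,\varphi\,dx\,dt+\int_{\mathbb R^n}E(u_o(x))\,\varphi(0,x)\,dx,$$ with $u=u(t,x)$, $\varphi=\varphi(t,x)$. *)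

theory Defs
  imports "HOL-Analysis.Analysis"
begin

section \<open>Functions of class C1 and smooth functions\<close>

text \<open>
  All derivatives are taken within the set \<open>S\<close>, hence are one-sided at boundary points that
  belong to \<open>S\<close>. The notions below are only used for \<open>S = J \<times> UNIV\<close> with \<open>J\<close> a nondegenerate
  interval; there the derivative within \<open>S\<close> is unique.
\<close>

definition partial_within ::
  "'a::euclidean_space set \<Rightarrow> 'a \<Rightarrow> ('a \<Rightarrow> 'b::real_normed_vector) \<Rightarrow> 'a \<Rightarrow> 'b" where
  "partial_within S b h p = frechet_derivative h (at p within S) b"

definition C1_on :: "'a::euclidean_space set \<Rightarrow> ('a \<Rightarrow> 'b::real_normed_vector) \<Rightarrow> bool" where
  "C1_on S h \<longleftrightarrow>
     h differentiable_on S \<and> (\<forall>b\<in>Basis. continuous_on S (partial_within S b h))"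

fun iter_partial ::
  "'a::euclidean_space set \<Rightarrow> 'a list \<Rightarrow> ('a \<Rightarrow> 'b::real_normed_vector) \<Rightarrow> 'a \<Rightarrow> 'b" where
  "iter_partial S [] h = h"
| "iter_partial S (b # bs) h = iter_partial S bs (partial_within S b h)"

definition smooth_within :: "'a::euclidean_space set \<Rightarrow> ('a \<Rightarrow> 'b::real_normed_vector) \<Rightarrow> bool" where
  "smooth_within S h \<longleftrightarrow> (\<forall>bs\<in>lists Basis. iter_partial S bs h differentiable_on S)"

text \<open>The case distinction is needed because \<^term>\<open>Sup ({} :: real set)\<close> is unspecified.\<close>

definition sup_norm_on :: "'a set \<Rightarrow> ('a \<Rightarrow> 'b::real_normed_vector) \<Rightarrow> real" where
  "sup_norm_on K h = (if K = {} then 0 else (SUP p\<in>K. norm (h p)))"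

section \<open>The space of fluxes\<close>

definition time_interval :: "real set \<Rightarrow> bool" where
  "time_interval I \<longleftrightarrow> I = {0..} \<or> (\<exists>T>0. I = {0..<T})"

text \<open>Partial derivatives of \<open>\<zeta>(t,x,u)\<close>. The one in \<open>t\<close> is taken within the closure of \<open>I\<close>.\<close>

definition pd_t :: "real set \<Rightarrow> (real \<times> (real^'n) \<times> real \<Rightarrow> 'b::real_normed_vector)
    \<Rightarrow> real \<times> (real^'n) \<times> real \<Rightarrow> 'b" where
  "pd_t I \<zeta> = (\<lambda>(t, x, u). vector_derivative (\<lambda>s. \<zeta> (s, x, u)) (at t within closure I))"

definition pd_u :: "(real \<times> (real^'n) \<times> real \<Rightarrow> 'b::real_normed_vector)
    \<Rightarrow> real \<times> (real^'n) \<times> real \<Rightarrow> 'b" where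
  "pd_u \<zeta> = (\<lambda>(t, x, u). vector_derivative (\<lambda>v. \<zeta> (t, x, v)) (at u))"

text \<open>
  The \<open>i\<close>-th component of \<open>grad_x \<zeta>\<close> is the partial derivative of \<open>\<zeta>\<close> in \<open>x\<^sub>i\<close>; for
  vector-valued \<open>\<zeta>\<close> the entry \<open>(i,j)\<close> is the partial derivative of \<open>\<zeta>\<^sub>j\<close> in \<open>x\<^sub>i\<close>.
\<close>

definition grad_x :: "(real \<times> (real^'n) \<times> real \<Rightarrow> 'b::real_normed_vector)
    \<Rightarrow> real \<times> (real^'n) \<times> real \<Rightarrow> 'b^'n" where
  "grad_x \<zeta> = (\<lambda>(t, x, u). \<chi> i. frechet_derivative (\<lambda>y. \<zeta> (t, y, u)) (at x) (axis i 1))"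

definition div_x :: "(real \<times> (real^'n) \<times> real \<Rightarrow> real^'n) \<Rightarrow> real \<times> (real^'n) \<times> real \<Rightarrow> real" where
  "div_x F p = (\<Sum>i\<in>UNIV. grad_x F p $ i $ i)"

text \<open>
  With values in \<open>real\<close> this is the space \<open>\<F>\<close>, with values in \<open>real^'n\<close> the space \<open>\<F>\<^sup>n\<close>.
  Values of \<open>\<zeta>\<close> outside \<open>closure I \<times> UNIV \<times> UNIV\<close> are irrelevant.
\<close>

definition flux_space ::
  "real set \<Rightarrow> (real \<times> (real^'n) \<times> real \<Rightarrow> 'b::real_normed_vector) set" where
  "flux_space I = {\<zeta>.
     C1_on (closure I \<times> UNIV \<times> UNIV) \<zeta> \<and>
     (\<forall>t\<in>closure I. \<forall>x u.
        (\<lambda>s. pd_u \<zeta> (s, x, u)) differentiable (at t within closure I) \<and>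
        (\<lambda>y. pd_u \<zeta> (t, y, u)) differentiable (at x)) \<and>
     continuous_on (closure I \<times> UNIV \<times> UNIV) (pd_t I (pd_u \<zeta>)) \<and>
     continuous_on (closure I \<times> UNIV \<times> UNIV) (grad_x (pd_u \<zeta>))}"

definition flux_seminorm ::
  "real set \<Rightarrow> (real \<times> (real^'n) \<times> real) set \<Rightarrow>
   (real \<times> (real^'n) \<times> real \<Rightarrow> 'b::real_normed_vector) \<Rightarrow> real" where
  "flux_seminorm I K \<zeta> =
     (sup_norm_on K \<zeta> + sup_norm_on K (pd_t I \<zeta>) + sup_norm_on K (grad_x \<zeta>)
        + sup_norm_on K (pd_u \<zeta>))
     + sup_norm_on K (pd_t I (pd_u \<zeta>)) + sup_norm_on K (grad_x (pd_u \<zeta>))"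

section \<open>Essentially bounded functions\<close>

definition Linf_on :: "'a::euclidean_space set \<Rightarrow> ('a \<Rightarrow> real) set" where
  "Linf_on S = {w. w \<in> borel_measurable (lebesgue_on S) \<and>
                   (\<exists>C. AE p in lebesgue_on S. \<bar>w p\<bar> \<le> C)}"

definition bounded_Linf_loc :: "'a::euclidean_space set \<Rightarrow> (nat \<Rightarrow> 'a \<Rightarrow> real) \<Rightarrow> bool" where
  "bounded_Linf_loc S w \<longleftrightarrow>
     (\<forall>K. compact K \<and> K \<subseteq> S \<longrightarrow> (\<exists>C. \<forall>\<nu>. AE p in lebesgue_on K. \<bar>w \<nu> p\<bar> \<le> C))"

definition C1_converges :: "(nat \<Rightarrow> real \<Rightarrow> real) \<Rightarrow> (real \<Rightarrow> real) \<Rightarrow> bool" where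
  "C1_converges E\<^sub>\<nu> E \<longleftrightarrow>
     (\<forall>K. compact K \<longrightarrow> uniform_limit K E\<^sub>\<nu> E sequentially \<and>
                        uniform_limit K (\<lambda>\<nu>. deriv (E\<^sub>\<nu> \<nu>)) (deriv E) sequentially)"

section \<open>Test functions and distributions\<close>

text \<open>
  Test functions are smooth up to \<open>t = 0\<close> and may be nonzero there. They are represented by
  total functions whose values outside \<open>I \<times> UNIV\<close> are irrelevant.
\<close>

definition test_functions :: "real set \<Rightarrow> (real \<times> (real^'n) \<Rightarrow> real) set" where
  "test_functions I = {\<phi>.
     smooth_within (I \<times> UNIV) \<phi> \<and>
     compact (closure (support_on (I \<times> UNIV) \<phi>)) \<and>
     closure (support_on (I \<times> UNIV) \<phi>) \<subseteq> I \<times> UNIV}"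

definition Cm_norm_on ::
  "real set \<Rightarrow> (real \<times> (real^'n)) set \<Rightarrow> nat \<Rightarrow> (real \<times> (real^'n) \<Rightarrow> real) \<Rightarrow> real" where
  "Cm_norm_on I K m \<phi> =
     (\<Sum>bs | set bs \<subseteq> Basis \<and> length bs \<le> m. sup_norm_on K (iter_partial (I \<times> UNIV) bs \<phi>))"

text \<open>
  Continuity of a linear functional is expressed by the usual seminorm estimates on compact
  sets. These also force \<open>T \<phi> = T \<psi>\<close> if \<open>\<phi>\<close> and \<open>\<psi>\<close> agree on \<open>I \<times> UNIV\<close>.
\<close>

definition distributions :: "real set \<Rightarrow> ((real \<times> (real^'n) \<Rightarrow> real) \<Rightarrow> real) set" where
  "distributions I = {T.
     T \<in> extensional (test_functions I) \<and>
     (\<forall>\<phi>\<in>test_functions I. \<forall>\<psi>\<in>test_functions I. T (\<lambda>p. \<phi> p + \<psi> p) = T \<phi> + T \<psi>) \<and>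
     (\<forall>c. \<forall>\<phi>\<in>test_functions I. T (\<lambda>p. c * \<phi> p) = c * T \<phi>) \<and>
     (\<forall>K. compact K \<and> K \<subseteq> I \<times> UNIV \<longrightarrow>
        (\<exists>C m. \<forall>\<phi>\<in>test_functions I. support_on (I \<times> UNIV) \<phi> \<subseteq> K \<longrightarrow>
           \<bar>T \<phi>\<bar> \<le> C * Cm_norm_on I K m \<phi>))}"

definition weak_star_topology ::
  "real set \<Rightarrow> ((real \<times> (real^'n) \<Rightarrow> real) \<Rightarrow> real) topology" where
  "weak_star_topology I =
     subtopology (product_topology (\<lambda>_. euclideanreal) (test_functions I)) (distributions I)"

lemma limitin_weak_star:
  "limitin (weak_star_topology I) M L F \<longleftrightarrow>
     L \<in> distributions I \<and> (\<forall>\<^sub>F \<nu> in F. M \<nu> \<in> distributions I) \<and>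
     (\<forall>\<phi>\<in>test_functions I. ((\<lambda>\<nu>. M \<nu> \<phi>) \<longlongrightarrow> L \<phi>) F)"
proof -
  have "distributions I \<subseteq> extensional (test_functions I)"
    by (auto simp: distributions_def)
  then show ?thesis
    by (auto simp: weak_star_topology_def limitin_subtopology limitin_componentwise PiE_def
             elim: eventually_mono)
qed

section \<open>Entropy production\<close>

definition entropy_flux ::
  "real set \<Rightarrow> (real \<times> (real^'n) \<times> real \<Rightarrow> real^'n) \<Rightarrow> (real \<Rightarrow> real) \<Rightarrow>
   (real \<times> (real^'n) \<times> real \<Rightarrow> real^'n) \<Rightarrow> bool" where
  "entropy_flux I f E F \<longleftrightarrow> F \<in> flux_space I \<and>
     (\<forall>t\<in>closure I. \<forall>x u. pd_u F (t, x, u) = deriv E u *\<^sub>R pd_u f (t, x, u))"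

definition test_dt :: "real set \<Rightarrow> (real \<times> (real^'n) \<Rightarrow> real) \<Rightarrow> real \<times> (real^'n) \<Rightarrow> real" where
  "test_dt I \<phi> = (\<lambda>(t, x). vector_derivative (\<lambda>s. \<phi> (s, x)) (at t within I))"

definition test_grad :: "(real \<times> (real^'n) \<Rightarrow> real) \<Rightarrow> real \<times> (real^'n) \<Rightarrow> real^'n" where
  "test_grad \<phi> = (\<lambda>(t, x). \<chi> i. frechet_derivative (\<lambda>y. \<phi> (t, y)) (at x) (axis i 1))"

text \<open>
  The choice operator picks an arbitrary entropy flux; the value does not depend on the choice.
\<close>

definition entropy_production ::
  "real set \<Rightarrow> (real \<times> (real^'n) \<times> real \<Rightarrow> real^'n) \<Rightarrow> (real \<times> (real^'n) \<times> real \<Rightarrow> real) \<Rightarrow>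
   ((real^'n) \<Rightarrow> real) \<Rightarrow> (real \<times> (real^'n) \<Rightarrow> real) \<Rightarrow> (real \<Rightarrow> real) \<Rightarrow>
   (real \<times> (real^'n) \<Rightarrow> real) \<Rightarrow> real" where
  "entropy_production I f g u\<^sub>o u E =
    (let F = (SOME F. entropy_flux I f E F) in
     (\<lambda>\<phi>\<in>test_functions I.
        (LINT (t, x)|lebesgue_on (I \<times> UNIV).
           E (u (t, x)) * test_dt I \<phi> (t, x) + F (t, x, u (t, x)) \<bullet> test_grad \<phi> (t, x))
      - (LINT (t, x)|lebesgue_on (I \<times> UNIV).
           deriv E (u (t, x)) * div_x f (t, x, u (t, x)) * \<phi> (t, x))
      + (LINT (t, x)|lebesgue_on (I \<times> UNIV). div_x F (t, x, u (t, x)) * \<phi> (t, x))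
      + (LINT (t, x)|lebesgue_on (I \<times> UNIV).
           deriv E (u (t, x)) * g (t, x, u (t, x)) * \<phi> (t, x))
      + (LINT x|lebesgue. E (u\<^sub>o x) * \<phi> (0, x))))"

end

theory Submission
  imports Defs
begin

text \<open>
The functional \<open>\<M>\<^sub>u(E)\<close> involves an arbitrarily chosen entropy flux, and the fluxes chosen for
different \<open>\<nu>\<close> need not converge: two fluxes for the same \<open>E\<close> and \<open>f\<close> may differ by any field
\<open>D(t,x)\<close> of class C1. The first point is therefore that the choice does not matter. Every flux
is \<open>F(t,x,u) = G(t,x,u) + F(t,x,0)\<close> with the flux \<open>G(t,x,u) = \<integral>\<^sub>0\<^sup>u E'(w) \<partial>\<^sub>uf(t,x,w) dw\<close> that vanishes
at \<open>u = 0\<close> (\<open>entropy_flux_unique\<close>), and \<open>D(t,x) = F(t,x,0)\<close> enters only through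
\<open>\<integral> D \<bullet> \<nabla>\<phi> + (div D) \<phi> = \<integral> div (\<phi> D)\<close>, which vanishes because \<open>\<phi>\<close> has compact support in \<open>x\<close>
(\<open>integral_div_test_function_eq_0\<close>). That \<open>G\<close> is itself an entropy flux, so that the choice
operator does return one, is differentiation under the integral sign (\<open>entropy_flux_normalised\<close>).

With \<open>G\<close> in place of \<open>F\<close>, the space-time terms combine into one integral of
\<open>H(t,x,u(t,x)) \<bullet> (\<partial>\<^sub>t\<phi>, \<nabla>\<phi>, \<phi>)\<close>, where the density
\<open>H = (E, G, E' (g - div f) + div G)\<close> is continuous (\<open>entropy_production_eq\<close>). On compact sets,
with \<open>u\<close> essentially bounded, such an integral is bounded by the C1 norm of \<open>\<phi>\<close>; hence the
functionals are distributions.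

For the limit, \<open>G\<close> and \<open>div G\<close> are primitives in \<open>u\<close> of \<open>E' \<partial>\<^sub>uf\<close> and \<open>E' div \<partial>\<^sub>uf\<close>. The seminorms
\<open>p\<^sub>K\<close> control \<open>\<partial>\<^sub>uf\<close> and \<open>\<nabla>\<^sub>x\<partial>\<^sub>uf\<close> uniformly on compact sets, and \<open>E'\<^sub>\<nu>\<close> converges locally uniformly, so
\<open>H\<^sub>\<nu>\<close> converges to \<open>H\<close> locally uniformly (\<open>uniform_limit_production_density\<close>). Since \<open>u\<^sup>\<nu>\<close> converges
almost everywhere and is bounded on the support of \<open>\<phi>\<close>, dominated convergence gives the claim
(\<open>tendsto_pairing\<close>); the initial term is the same statement on \<open>\<real>\<^sup>n\<close> with the density \<open>E(u)\<close>.
\<close>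

section \<open>Superposition integrals\<close>

text \<open>
The function \<open>h\<close> is controlled only on \<open>S \<times> \<real>\<close>, so it is first cut off by the indicator of this
Borel set. Its Borel measurability is what allows a merely Lebesgue measurable inner function.
\<close>

lemma measurable_continuous_compose:
  fixes h :: "'a::euclidean_space \<times> real \<Rightarrow> 'b::euclidean_space"
  assumes S: "S \<in> sets borel" and h: "continuous_on (S \<times> UNIV) h"
    and u: "u \<in> borel_measurable (lebesgue_on S)"
  shows "(\<lambda>p. h (p, u p)) \<in> borel_measurable (lebesgue_on S)"
proof -
  have SU: "S \<times> (UNIV :: real set) \<in> sets borel"
    using S by (intro borel_Times) auto
  have id: "(\<lambda>p. p) \<in> borel_measurable (lebesgue_on S)"
    using id_borel_measurable_lebesgue_on[of S] by (simp add: id_def)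
  have "(\<lambda>p. (p, u p)) \<in> borel_measurable (lebesgue_on S)"
    using id u by (simp add: borel_prod[symmetric])
  with borel_measurable_continuous_on_indicator[OF SU h]
  have "(\<lambda>p. indicat_real (S \<times> UNIV) (p, u p) *\<^sub>R h (p, u p)) \<in> borel_measurable (lebesgue_on S)"
    by (rule measurable_compose[rotated])
  then show ?thesis
    by (rule measurable_cong[THEN iffD1, rotated]) simp
qed

text \<open>
The integrand vanishes off the compact set \<open>K\<close>, and on \<open>K\<close> it is at most \<open>B * M\<close> almost
everywhere. The dominating function is part of the conclusion because the constants depend on
\<open>u\<close> only through \<open>C\<close>, so that it can serve a whole sequence in dominated convergence.
\<close>

lemma integrable_pairing:
  fixes h :: "'a::euclidean_space \<times> real \<Rightarrow> 'b::euclidean_space" and \<psi> :: "'a \<Rightarrow> 'b"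
  assumes S: "S \<in> sets borel" and K: "compact K" "K \<subseteq> S"
    and h: "continuous_on (S \<times> UNIV) h" and u: "u \<in> borel_measurable (lebesgue_on S)"
    and \<psi>: "continuous_on S \<psi>" "\<And>p. p \<in> S - K \<Longrightarrow> \<psi> p = 0"
    and uC: "AE p in lebesgue_on S. p \<in> K \<longrightarrow> \<bar>u p\<bar> \<le> C"
    and B: "\<And>p w. p \<in> K \<Longrightarrow> \<bar>w\<bar> \<le> C \<Longrightarrow> norm (h (p, w)) \<le> B"
    and M: "\<And>p. p \<in> K \<Longrightarrow> norm (\<psi> p) \<le> M"
    and nn: "0 \<le> B" "0 \<le> M"
  shows "integrable (lebesgue_on S) (\<lambda>p. h (p, u p) \<bullet> \<psi> p)"
    and "\<bar>LINT p|lebesgue_on S. h (p, u p) \<bullet> \<psi> p\<bar> \<le> B * M * measure lebesgue K"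
    and "AE p in lebesgue_on S. norm (h (p, u p) \<bullet> \<psi> p) \<le> B * M * indicator K p"
    and "(\<lambda>p. h (p, u p) \<bullet> \<psi> p) \<in> borel_measurable (lebesgue_on S)"
    and "integrable (lebesgue_on S) (\<lambda>p. B * M * indicator K p :: real)"
proof -
  have Sl: "S \<in> sets lebesgue" using S by auto
  have Kl: "K \<in> lmeasurable" using K(1) by (rule lmeasurable_compact)
  have KS: "K \<in> sets (lebesgue_on S)"
    using K(2) Kl Sl by (simp add: fmeasurableD sets_restrict_space_iff)
  have emK: "emeasure (lebesgue_on S) K = emeasure lebesgue K"
    using K(2) Sl by (simp add: emeasure_restrict_space)
  have meK: "measure (lebesgue_on S) K = measure lebesgue K"
    using emK by (simp add: measure_def)
  show m: "(\<lambda>p. h (p, u p) \<bullet> \<psi> p) \<in> borel_measurable (lebesgue_on S)"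
    by (intro borel_measurable_inner measurable_continuous_compose[OF S h u]
        continuous_imp_measurable_on_sets_lebesgue[OF \<psi>(1) Sl])
  have ind: "has_bochner_integral (lebesgue_on S) (\<lambda>p. indicator K p *\<^sub>R (B * M))
      (measure (lebesgue_on S) K *\<^sub>R (B * M))"
    using KS emK Kl by (intro has_bochner_integral_indicator) (auto simp: fmeasurable_def)
  show dom: "integrable (lebesgue_on S) (\<lambda>p. B * M * indicator K p :: real)"
    using ind by (auto simp: has_bochner_integral_iff mult.commute)
  show bd: "AE p in lebesgue_on S. norm (h (p, u p) \<bullet> \<psi> p) \<le> B * M * indicator K p"
    using uC AE_space
  proof eventually_elim
    case (elim p)
    show ?case
    proof (cases "p \<in> K")
      case True
      have "norm (h (p, u p) \<bullet> \<psi> p) \<le> norm (h (p, u p)) * norm (\<psi> p)"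
        by (simp add: Cauchy_Schwarz_ineq2)
      also have "\<dots> \<le> B * M"
        using True elim nn by (intro mult_mono B M) auto
      finally show ?thesis using True by simp
    next
      case False
      then show ?thesis using elim \<psi>(2)[of p] by simp
    qed
  qed
  show int: "integrable (lebesgue_on S) (\<lambda>p. h (p, u p) \<bullet> \<psi> p)"
    by (rule Bochner_Integration.integrable_bound[OF dom m])
      (use bd nn in \<open>auto elim!: eventually_mono\<close>)
  have "norm (LINT p|lebesgue_on S. h (p, u p) \<bullet> \<psi> p)
      \<le> (LINT p|lebesgue_on S. norm (h (p, u p) \<bullet> \<psi> p))"
    by (rule integral_norm_bound)
  also have "\<dots> \<le> (LINT p|lebesgue_on S. B * M * indicator K p)"
    by (rule integral_mono_AE[OF integrable_norm[OF int] dom bd])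
  also have "\<dots> = B * M * measure lebesgue K"
    using ind meK by (auto simp: has_bochner_integral_iff mult.commute)
  finally show "\<bar>LINT p|lebesgue_on S. h (p, u p) \<bullet> \<psi> p\<bar> \<le> B * M * measure lebesgue K"
    by simp
qed

lemma pairing_bound_exists:
  fixes h :: "'a::euclidean_space \<times> real \<Rightarrow> 'b::euclidean_space"
  assumes K: "compact K" "K \<subseteq> S" and h: "continuous_on (S \<times> UNIV) h"
  shows "\<exists>B\<ge>0. \<forall>p\<in>K. \<forall>w. \<bar>w\<bar> \<le> C \<longrightarrow> norm (h (p, w)) \<le> B"
proof -
  have "compact (K \<times> {-C..C})" "continuous_on (K \<times> {-C..C}) h"
    using K by (auto intro: compact_Times continuous_on_subset[OF h])
  then obtain B where B: "0 \<le> B" "\<And>q. q \<in> K \<times> {-C..C} \<Longrightarrow> norm (h q) \<le> B"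
    by (rule continuous_on_compact_bound) blast
  have "norm (h (p, w)) \<le> B" if "p \<in> K" "\<bar>w\<bar> \<le> C" for p w
    using B(2)[of "(p, w)"] that by (auto simp: abs_le_iff)
  then show ?thesis using B(1) by blast
qed

text \<open>
Local uniform convergence of \<open>hs\<close> does two things: combined with continuity of \<open>h\<close> it turns
\<open>us n p \<longlonglongrightarrow> u p\<close> into convergence of the integrands, and it bounds \<open>hs n\<close> on \<open>K \<times> [-C, C]\<close> by
\<open>sup \<bar>h\<bar> + 1\<close> for all large \<open>n\<close>, which makes the integrands dominated.
\<close>

lemma tendsto_pairing:
  fixes h :: "'a::euclidean_space \<times> real \<Rightarrow> 'b::euclidean_space" and \<psi> :: "'a \<Rightarrow> 'b"
  assumes S: "S \<in> sets borel" and K: "compact K" "K \<subseteq> S"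
    and h: "continuous_on (S \<times> UNIV) h" "\<And>n. continuous_on (S \<times> UNIV) (hs n)"
    and u: "u \<in> borel_measurable (lebesgue_on S)" "\<And>n. us n \<in> borel_measurable (lebesgue_on S)"
    and \<psi>: "continuous_on S \<psi>" "\<And>p. p \<in> S - K \<Longrightarrow> \<psi> p = 0"
    and uC: "\<And>n. AE p in lebesgue_on S. p \<in> K \<longrightarrow> \<bar>us n p\<bar> \<le> C"
    and u_lim: "AE p in lebesgue_on S. (\<lambda>n. us n p) \<longlonglongrightarrow> u p"
    and h_lim: "\<And>C. uniform_limit (K \<times> {-C..C}) hs h sequentially"
  shows "(\<lambda>n. LINT p|lebesgue_on S. hs n (p, us n p) \<bullet> \<psi> p)
     \<longlonglongrightarrow> (LINT p|lebesgue_on S. h (p, u p) \<bullet> \<psi> p)"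
proof -
  obtain B where B: "0 \<le> B" "\<And>p w. p \<in> K \<Longrightarrow> \<bar>w\<bar> \<le> C \<Longrightarrow> norm (h (p, w)) \<le> B"
    using pairing_bound_exists[OF K h(1)] by blast
  obtain M where M: "\<And>p. p \<in> K \<Longrightarrow> norm (\<psi> p) \<le> M" "0 \<le> M"
    using continuous_on_compact_bound[OF K(1) continuous_on_subset[OF \<psi>(1) K(2)]] by blast
  have "\<forall>\<^sub>F n in sequentially. \<forall>q\<in>K \<times> {-C..C}. dist (hs n q) (h q) < 1"
    using h_lim by (rule uniform_limitD) simp
  then obtain N where N: "\<And>n q. N \<le> n \<Longrightarrow> q \<in> K \<times> {-C..C} \<Longrightarrow> dist (hs n q) (h q) < 1"
    by (auto simp: eventually_sequentially)
  have bd: "norm (hs (n + N) (p, w)) \<le> B + 1" if "p \<in> K" "\<bar>w\<bar> \<le> C" for n p w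
  proof -
    have "dist (hs (n + N) (p, w)) (h (p, w)) < 1"
      using that by (intro N) auto
    moreover have "norm (hs (n + N) (p, w)) \<le> norm (h (p, w)) + dist (hs (n + N) (p, w)) (h (p, w))"
      by (metis dist_norm norm_triangle_sub)
    ultimately show ?thesis using B(2)[OF that] by linarith
  qed
  have P: "AE p in lebesgue_on S. norm (hs (n + N) (p, us (n + N) p) \<bullet> \<psi> p) \<le> (B + 1) * M * indicator K p"
      "(\<lambda>p. hs (n + N) (p, us (n + N) p) \<bullet> \<psi> p) \<in> borel_measurable (lebesgue_on S)"
      "integrable (lebesgue_on S) (\<lambda>p. (B + 1) * M * indicator K p :: real)" for n
    using integrable_pairing(3-5)[OF S K h(2)[of "n + N"] u(2)[of "n + N"] \<psi> uC[of "n + N"],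
        where B = "B + 1" and M = M, OF _ bd M(1) _ M(2)] B(1) by simp_all
  have m: "(\<lambda>p. h (p, u p) \<bullet> \<psi> p) \<in> borel_measurable (lebesgue_on S)"
    using S by (intro borel_measurable_inner measurable_continuous_compose[OF S h(1) u(1)]
        continuous_imp_measurable_on_sets_lebesgue[OF \<psi>(1)]) auto
  have lim: "AE p in lebesgue_on S.
      (\<lambda>n. hs (n + N) (p, us (n + N) p) \<bullet> \<psi> p) \<longlonglongrightarrow> h (p, u p) \<bullet> \<psi> p"
  proof -
    have "AE p in lebesgue_on S. \<forall>n. p \<in> K \<longrightarrow> \<bar>us n p\<bar> \<le> C"
      unfolding AE_all_countable using uC by blast
    with u_lim AE_space show ?thesis
    proof eventually_elim
      case (elim p)
      show ?case
      proof (cases "p \<in> K")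
        case False
        then show ?thesis using elim \<psi>(2)[of p] by simp
      next
        case True
        then have C: "\<bar>us n p\<bar> \<le> C" for n using elim by auto
        have pw: "(\<lambda>n. (p, us n p)) \<longlonglongrightarrow> (p, u p)"
          using elim by (intro tendsto_Pair tendsto_const)
        have mem: "(p, us n p) \<in> K \<times> {-C..C}" for n
          using True C[of n] by auto
        have "(\<lambda>n. h (p, us n p)) \<longlonglongrightarrow> h (p, u p)"
          using h(1)[unfolded continuous_on_sequentially] pw True K(2)
          by (auto simp: o_def subset_iff)
        moreover have "(\<lambda>n. hs n (p, us n p) - h (p, us n p)) \<longlonglongrightarrow> 0"
        proof (rule tendstoI)
          fix e :: real assume "e > 0"
          from uniform_limitD[OF h_lim this, of C]
          show "\<forall>\<^sub>F n in sequentially. dist (hs n (p, us n p) - h (p, us n p)) 0 < e"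
            by eventually_elim (use mem in \<open>auto simp: dist_norm\<close>)
        qed
        ultimately have "(\<lambda>n. (hs n (p, us n p) - h (p, us n p)) + h (p, us n p))
            \<longlonglongrightarrow> 0 + h (p, u p)"
          by (rule tendsto_add[rotated])
        then have "(\<lambda>n. hs n (p, us n p)) \<longlonglongrightarrow> h (p, u p)" by simp
        from LIMSEQ_ignore_initial_segment[OF this, of N]
        show ?thesis by (intro tendsto_intros)
      qed
    qed
  qed
  have "(\<lambda>n. LINT p|lebesgue_on S. hs (n + N) (p, us (n + N) p) \<bullet> \<psi> p)
     \<longlonglongrightarrow> (LINT p|lebesgue_on S. h (p, u p) \<bullet> \<psi> p)"
    by (rule integral_dominated_convergence[OF m P(2) P(3) lim P(1)])
  then show ?thesis by (rule LIMSEQ_offset)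
qed

lemma integral_pairing_bounded:
  fixes h :: "'a::euclidean_space \<times> real \<Rightarrow> 'b::euclidean_space"
  assumes S: "S \<in> sets borel" and K: "compact K" "K \<subseteq> S"
    and h: "continuous_on (S \<times> UNIV) h" and u: "u \<in> Linf_on S"
  shows "\<exists>B. \<forall>\<psi> M. continuous_on S \<psi> \<longrightarrow> (\<forall>p\<in>S - K. \<psi> p = 0) \<longrightarrow> 0 \<le> M \<longrightarrow>
      (\<forall>p\<in>K. norm (\<psi> p) \<le> M) \<longrightarrow> \<bar>LINT p|lebesgue_on S. h (p, u p) \<bullet> \<psi> p\<bar> \<le> B * M"
proof -
  obtain C where C: "AE p in lebesgue_on S. \<bar>u p\<bar> \<le> C" and um: "u \<in> borel_measurable (lebesgue_on S)"
    using u by (auto simp: Linf_on_def)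
  obtain B where B: "0 \<le> B" "\<And>p w. p \<in> K \<Longrightarrow> \<bar>w\<bar> \<le> C \<Longrightarrow> norm (h (p, w)) \<le> B"
    using pairing_bound_exists[OF K h] by blast
  have C': "AE p in lebesgue_on S. p \<in> K \<longrightarrow> \<bar>u p\<bar> \<le> C" using C by auto
  have "\<bar>LINT p|lebesgue_on S. h (p, u p) \<bullet> \<psi> p\<bar> \<le> (B * measure lebesgue K) * M"
    if "continuous_on S \<psi>" "\<forall>p\<in>S - K. \<psi> p = 0" "0 \<le> M" "\<forall>p\<in>K. norm (\<psi> p) \<le> M" for \<psi> M
    using integrable_pairing(2)[OF S K h um that(1) _ C' B(2) _ B(1) that(3)] that(2,4)
    by (simp add: mult_ac)
  then show ?thesis by blast
qed

lemma integrable_pairing_Linf: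
  fixes h :: "'a::euclidean_space \<times> real \<Rightarrow> 'b::euclidean_space"
  assumes S: "S \<in> sets borel" and K: "compact K" "K \<subseteq> S"
    and h: "continuous_on (S \<times> UNIV) h" and u: "u \<in> Linf_on S"
    and \<psi>: "continuous_on S \<psi>" "\<And>p. p \<in> S - K \<Longrightarrow> \<psi> p = 0"
  shows "integrable (lebesgue_on S) (\<lambda>p. h (p, u p) \<bullet> \<psi> p)"
proof -
  obtain C where C: "AE p in lebesgue_on S. \<bar>u p\<bar> \<le> C" and um: "u \<in> borel_measurable (lebesgue_on S)"
    using u by (auto simp: Linf_on_def)
  obtain B where B: "0 \<le> B" "\<And>p w. p \<in> K \<Longrightarrow> \<bar>w\<bar> \<le> C \<Longrightarrow> norm (h (p, w)) \<le> B"
    using pairing_bound_exists[OF K h] by blast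
  obtain M where M: "0 \<le> M" "\<And>p. p \<in> K \<Longrightarrow> norm (\<psi> p) \<le> M"
    using continuous_on_compact_bound[OF K(1) continuous_on_subset[OF \<psi>(1) K(2)]] by blast
  have C': "AE p in lebesgue_on S. p \<in> K \<longrightarrow> \<bar>u p\<bar> \<le> C" using C by auto
  show ?thesis
    by (rule integrable_pairing(1)[OF S K h um \<psi>(1) _ C' B(2) M(2) B(1) M(1)]) (use \<psi>(2) in auto)
qed

section \<open>Integration by parts\<close>

text \<open>
Extended by zero off \<open>S\<close>, the function \<open>k\<close> has an integral that does not change under translation
by \<open>s e\<close>. The difference quotients of \<open>s \<mapsto> \<integral>k(p + s e)\<close> at \<open>s = 0\<close> are therefore zero, and by the
mean value theorem they converge boundedly to \<open>\<integral>k'\<close>. The set \<open>S\<close> has to be invariant in the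
direction \<open>e\<close> only, so \<open>S\<close> may be a slab \<open>[0,T) \<times> \<real>\<^sup>n\<close> and \<open>k\<close> need not vanish at \<open>t = 0\<close>.
\<close>

lemma integral_directional_derivative_eq_0:
  fixes k k' :: "'a::euclidean_space \<Rightarrow> real"
  assumes S: "S \<in> sets borel" and inv: "\<And>p s. p \<in> S \<Longrightarrow> p + s *\<^sub>R e \<in> S"
    and K: "compact K" "K \<subseteq> S"
    and k: "continuous_on S k" "\<And>p. p \<in> S - K \<Longrightarrow> k p = 0"
    and k': "continuous_on S k'" "\<And>p. p \<in> S - K \<Longrightarrow> k' p = 0"
    and deriv: "\<And>p. p \<in> S \<Longrightarrow> ((\<lambda>s. k (p + s *\<^sub>R e)) has_real_derivative k' p) (at 0)"
  shows "(LINT p|lebesgue_on S. k' p) = 0"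
proof -
  define k0 where "k0 = (\<lambda>p. indicat_real S p *\<^sub>R k p)"
  define k1 where "k1 = (\<lambda>p. indicat_real S p *\<^sub>R k' p)"
  \<comment> \<open>\<open>L\<close> contains the supports of all difference quotients with step at most \<open>1\<close>.\<close>
  define L where "L = (\<lambda>(p, s). p - s *\<^sub>R e) ` (K \<times> {0..1::real})"
  have L: "compact L"
    unfolding L_def using K
    by (intro compact_continuous_image compact_Times) (auto simp: split_beta intro!: continuous_intros)
  have inv': "p + s *\<^sub>R e \<in> S \<longleftrightarrow> p \<in> S" for p s
    using inv[of p s] inv[of "p + s *\<^sub>R e" "-s"] by auto
  have meas: "k0 \<in> borel_measurable borel" "k1 \<in> borel_measurable borel"
    unfolding k0_def k1_def by (rule borel_measurable_continuous_on_indicator[OF S k(1)],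
      rule borel_measurable_continuous_on_indicator[OF S k'(1)])
  obtain B where B0: "0 \<le> B" "\<And>p. p \<in> K \<Longrightarrow> norm (k' p) \<le> B"
    using continuous_on_compact_bound[OF K(1) continuous_on_subset[OF k'(1) K(2)]] by blast
  have B: "\<bar>k' p\<bar> \<le> B" if "p \<in> S" for p
    using that B0(1) B0(2)[of p] k'(2)[of p] by (cases "p \<in> K") auto
  have deriv': "((\<lambda>s. k (p + s *\<^sub>R e)) has_real_derivative k' (p + \<sigma> *\<^sub>R e)) (at \<sigma>)"
    if "p \<in> S" for p \<sigma>
  proof -
    have "((\<lambda>s. k ((p + \<sigma> *\<^sub>R e) + s *\<^sub>R e)) has_real_derivative k' (p + \<sigma> *\<^sub>R e)) (at 0)"
      using that by (intro deriv inv)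
    then have "((\<lambda>s. k (p + (s + \<sigma>) *\<^sub>R e)) has_real_derivative k' (p + \<sigma> *\<^sub>R e)) (at 0)"
      by (simp add: algebra_simps)
    then show ?thesis
      using DERIV_shift[of "\<lambda>s. k (p + s *\<^sub>R e)" "k' (p + \<sigma> *\<^sub>R e)" 0 \<sigma>] by simp
  qed
  have mvt: "\<bar>k (p + s *\<^sub>R e) - k p\<bar> \<le> B * s" if ps: "p \<in> S" "0 < s" for p s
  proof -
    obtain \<sigma> where "k (p + s *\<^sub>R e) - k (p + 0 *\<^sub>R e) = (s - 0) * k' (p + \<sigma> *\<^sub>R e)"
      using MVT2[OF ps(2) deriv'[OF ps(1)]] by blast
    then show ?thesis
      using B[OF inv[OF ps(1)], of \<sigma>] ps by (simp add: abs_mult mult.commute mult_left_mono)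
  qed
  define s where "s = (\<lambda>n. 1 / real (Suc n))"
  have s: "0 < s n" "s n \<le> 1" for n by (auto simp: s_def)
  define q where "q = (\<lambda>n p. (k0 (s n *\<^sub>R e + p) - k0 p) / s n)"
  have qm: "q n \<in> borel_measurable borel" for n
  proof -
    have "(\<lambda>p. k0 (s n *\<^sub>R e + p)) \<in> borel_measurable borel"
      by (rule measurable_compose[OF _ meas(1)]) auto
    then show ?thesis unfolding q_def using meas by auto
  qed
  have qbd: "norm (q n p) \<le> B * indicator L p" for n p
  proof (cases "p \<in> S")
    case False
    then show ?thesis
      using inv'[of p "s n"] by (auto simp: q_def k0_def indicator_def add.commute B0(1))
  next
    case pS: True
    show ?thesis
    proof (cases "p \<in> L")
      case True
      then show ?thesis
        using mvt[OF pS s(1)[of n]] inv'[of p "s n"] pS s[of n]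
        by (simp add: q_def k0_def add.commute divide_le_eq)
    next
      case False
      have "p \<notin> K" using False by (force simp: L_def intro: bexI[of _ "(p, 0)"])
      moreover have "p + s n *\<^sub>R e \<notin> K"
        using False s[of n] by (force simp: L_def intro: bexI[of _ "(p + s n *\<^sub>R e, s n)"])
      ultimately have "k p = 0" "k (s n *\<^sub>R e + p) = 0"
        using k(2) pS inv[of p "s n"] by (auto simp: add.commute)
      then show ?thesis using False by (simp add: q_def k0_def)
    qed
  qed
  have dom: "integrable lborel (\<lambda>p. B * indicator L p :: real)"
    using L by (intro integrable_mult_right integrable_real_indicator)
      (use emeasure_compact_finite[OF L] L in \<open>auto simp: borel_compact\<close>)
  have k0_int: "integrable lborel k0"
  proof -
    have "integrable lborel (\<lambda>p. indicator K p *\<^sub>R k p)"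
      by (rule borel_integrable_compact) (use K k in \<open>auto intro: continuous_on_subset\<close>)
    moreover have "(\<lambda>p. indicator K p *\<^sub>R k p) = k0"
      using k(2) K(2) by (force simp: k0_def indicator_def)
    ultimately show ?thesis by simp
  qed
  have tr: "integrable lborel (\<lambda>p. k0 (c + p))"
      "(LINT p|lborel. k0 (c + p)) = (LINT p|lborel. k0 p)" for c
  proof -
    have "integrable (distr lborel borel ((+) c)) k0"
      using k0_int by (simp add: lborel_distr_plus)
    then show "integrable lborel (\<lambda>p. k0 (c + p))"
      by (subst (asm) integrable_distr_eq) (use meas in auto)
    have "(LINT p|lborel. k0 p) = (LINT p|distr lborel borel ((+) c). k0 p)"
      by (simp add: lborel_distr_plus)
    also have "\<dots> = (LINT p|lborel. k0 (c + p))"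
      by (subst integral_distr) (use meas in auto)
    finally show "(LINT p|lborel. k0 (c + p)) = (LINT p|lborel. k0 p)" ..
  qed
  have q0: "(LINT p|lborel. q n p) = 0" for n
    unfolding q_def using tr k0_int by (simp add: Bochner_Integration.integral_diff)
  have qlim: "(\<lambda>n. q n p) \<longlonglongrightarrow> k1 p" for p
  proof (cases "p \<in> S")
    case False
    then have "q n p = 0" "k1 p = 0" for n
      using inv'[of p "s n"] by (auto simp: q_def k0_def k1_def add.commute)
    then show ?thesis by simp
  next
    case True
    have "s \<longlonglongrightarrow> 0"
      unfolding s_def using LIMSEQ_inverse_real_of_nat by (simp add: inverse_eq_divide)
    then have "filterlim s (at 0) sequentially"
      using s(1) by (auto simp: filterlim_at less_imp_neq[THEN not_sym])
    moreover have "((\<lambda>s. (k (p + s *\<^sub>R e) - k p) / s) \<longlongrightarrow> k' p) (at 0)"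
      using deriv[OF True] by (simp add: DERIV_def)
    ultimately have "(\<lambda>n. (k (p + s n *\<^sub>R e) - k p) / s n) \<longlonglongrightarrow> k' p"
      by (rule filterlim_compose[rotated])
    then show ?thesis
      using True inv[OF True] by (simp add: q_def k0_def k1_def add.commute)
  qed
  have "(\<lambda>n. LINT p|lborel. q n p) \<longlonglongrightarrow> (LINT p|lborel. k1 p)"
    by (rule integral_dominated_convergence[OF _ _ dom])
      (use meas qm qlim qbd in auto)
  then have "(LINT p|lborel. k1 p) = 0"
    using q0 by (simp add: LIMSEQ_const_iff)
  moreover have "(LINT p|lebesgue_on S. k' p) = (LINT p|lborel. k1 p)"
    using S meas by (simp add: integral_restrict_space k1_def integral_completion)
  ultimately show ?thesis by simp
qed

section \<open>Derivatives on a time slab\<close>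

lemma time_interval_facts:
  assumes "time_interval I"
  shows "0 \<in> I" "I \<in> sets borel" "convex I" "convex (closure I)" "I \<subseteq> closure I"
    and "\<And>t. t \<in> I \<Longrightarrow> t islimpt I" "\<And>t. t \<in> closure I \<Longrightarrow> t islimpt closure I"
proof -
  have I: "I = {0..} \<or> (\<exists>T>0. I = {0..<T})"
    using assms by (simp add: time_interval_def)
  show "0 \<in> I" "I \<in> sets borel" "convex I" using I by auto
  then show cl: "convex (closure I)" "I \<subseteq> closure I"
    by (auto simp: convex_closure closure_subset)
  have ns: "\<exists>s\<in>I. s \<noteq> t" for t
    using I
  proof
    assume "I = {0..}"
    then show ?thesis by (intro bexI[of _ "\<bar>t\<bar> + 1"]) auto
  next
    assume "\<exists>T>0. I = {0..<T}"
    then obtain T where "0 < T" "I = {0..<T}" by blast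
    then show ?thesis
      by (intro bexI[of _ "if t = 0 then T / 2 else 0"]) auto
  qed
  then have ns': "I \<noteq> {t}" "closure I \<noteq> {t}" for t
    using ns[of t] cl(2) by blast+
  show "t islimpt I" if "t \<in> I" for t
    using that \<open>convex I\<close> ns' by (intro connected_imp_perfect convex_connected)
  show "t islimpt closure I" if "t \<in> closure I" for t
    using that cl ns' by (intro connected_imp_perfect convex_connected)
qed

text \<open>
At points of a slab, boundary points included, the derivative within the slab is unique because
each basis vector can be followed inside it for arbitrarily small nonzero parameters.
\<close>

lemma frechet_derivative_Times_UNIV:
  fixes h :: "real \<times> 'c::euclidean_space \<Rightarrow> 'b::real_normed_vector"
  assumes t: "t \<in> J" "t islimpt J"
    and D: "(h has_derivative D) (at (t, z) within J \<times> UNIV)"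
  shows "frechet_derivative h (at (t, z) within J \<times> UNIV) = D"
proof (rule frechet_derivative_unique_within[OF _ D])
  show "(h has_derivative frechet_derivative h (at (t, z) within J \<times> UNIV))
      (at (t, z) within J \<times> UNIV)"
    using D by (metis differentiableI frechet_derivative_works)
next
  fix b :: "real \<times> 'c" and e :: real
  assume b: "b \<in> Basis" and e: "e > 0"
  from b consider "b = (1, 0)" | v where "b = (0, v)"
    by (auto simp: Basis_prod_def)
  then show "\<exists>d. 0 < \<bar>d\<bar> \<and> \<bar>d\<bar> < e \<and> (t, z) + d *\<^sub>R b \<in> J \<times> UNIV"
  proof cases
    case 1
    obtain s where "s \<in> J" "s \<noteq> t" "dist s t < e"
      using t(2) e by (auto simp: islimpt_approachable)
    then show ?thesis using 1 by (intro exI[of _ "s - t"]) (auto simp: dist_real_def)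
  next
    case 2
    then show ?thesis using e t(1) by (intro exI[of _ "e / 2"]) auto
  qed
qed

lemma has_vector_derivative_time_section:
  fixes h :: "real \<times> 'c::real_normed_vector \<Rightarrow> 'b::real_normed_vector"
  assumes "(h has_derivative D) (at (t, z) within J \<times> UNIV)"
  shows "((\<lambda>s. h (s, z)) has_vector_derivative D (1, 0)) (at t within J)"
proof -
  have "((\<lambda>s. (s, z)) has_derivative (\<lambda>s. (s, 0))) (at t within J)"
    by (intro derivative_eq_intros) auto
  then have "((\<lambda>s. h (s, z)) has_derivative (\<lambda>s. D (s, 0))) (at t within J)"
    by (rule has_derivative_in_compose) (rule has_derivative_subset[OF assms], auto)
  moreover have "(\<lambda>s. D (s, 0)) = (\<lambda>s. s *\<^sub>R D (1, 0))"
  proof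
    fix s show "D (s, 0) = s *\<^sub>R D (1, 0)"
      using linear_scale[OF has_derivative_linear[OF assms], of s "(1, 0)"] by simp
  qed
  ultimately show ?thesis by (simp only: has_vector_derivative_def)
qed

lemma has_derivative_space_section:
  fixes h :: "real \<times> 'c::real_normed_vector \<Rightarrow> 'b::real_normed_vector"
  assumes "(h has_derivative D) (at (t, z) within J \<times> UNIV)" "t \<in> J"
  shows "((\<lambda>y. h (t, y)) has_derivative (\<lambda>k. D (0, k))) (at z)"
proof -
  have "((\<lambda>y. (t, y)) has_derivative (\<lambda>k. (0, k))) (at z)"
    by (intro derivative_eq_intros) auto
  then show ?thesis
    by (rule has_derivative_in_compose)
      (rule has_derivative_subset[OF assms(1)], use assms(2) in auto)
qed

lemma linear_vec_expansion:
  fixes L :: "real^'n \<Rightarrow> 'b::real_normed_vector"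
  assumes "linear L"
  shows "L k = (\<Sum>i\<in>UNIV. k $ i *\<^sub>R L (axis i 1))"
proof -
  have "L k = L (\<Sum>i\<in>UNIV. k $ i *\<^sub>R axis i 1)"
    by (simp add: basis_expansion flip: scalar_mult_eq_scaleR)
  also have "\<dots> = (\<Sum>i\<in>UNIV. k $ i *\<^sub>R L (axis i 1))"
    by (simp add: linear_sum[OF assms] linear_scale[OF assms])
  finally show ?thesis .
qed

lemma C1_onI:
  fixes h :: "real \<times> 'c::euclidean_space \<Rightarrow> 'b::real_normed_vector"
  assumes J: "\<And>t. t \<in> J \<Longrightarrow> t islimpt J"
    and D: "\<And>p. p \<in> J \<times> UNIV \<Longrightarrow> (h has_derivative D p) (at p within J \<times> UNIV)"
    and cont: "\<And>b. b \<in> Basis \<Longrightarrow> continuous_on (J \<times> UNIV) (\<lambda>p. D p b)"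
  shows "C1_on (J \<times> UNIV) h"
  unfolding C1_on_def
proof (intro conjI ballI)
  show "h differentiable_on J \<times> UNIV"
    unfolding differentiable_on_def using D differentiableI by blast
  fix b :: "real \<times> 'c" assume b: "b \<in> Basis"
  have "partial_within (J \<times> UNIV) b h p = D p b" if "p \<in> J \<times> UNIV" for p
  proof -
    obtain t z where p: "p = (t, z)" "t \<in> J" using \<open>p \<in> J \<times> UNIV\<close> by blast
    show ?thesis
      using frechet_derivative_Times_UNIV[OF p(2) J[OF p(2)] D[OF that, unfolded p(1)]]
      unfolding partial_within_def p(1) by (rule fun_cong)
  qed
  then show "continuous_on (J \<times> UNIV) (partial_within (J \<times> UNIV) b h)"
    by (intro continuous_on_eq[OF cont[OF b]]) (rule sym)
qed

text \<open>
The partial derivatives in \<open>t\<close>, \<open>x\<close> and \<open>u\<close> are defined by three different limits along sections;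
all of them are values of the one derivative of \<open>\<zeta>\<close> within the slab.
\<close>

lemma C1_on_sections:
  fixes \<zeta> :: "real \<times> (real^'n) \<times> real \<Rightarrow> 'b::real_normed_vector"
  assumes I: "time_interval I" and C1: "C1_on (closure I \<times> UNIV) \<zeta>" and t: "t \<in> closure I"
  shows "((\<lambda>s. \<zeta> (s, x, u)) has_vector_derivative pd_t I \<zeta> (t, x, u)) (at t within closure I)"
    and "((\<lambda>v. \<zeta> (t, x, v)) has_vector_derivative pd_u \<zeta> (t, x, u)) (at u)"
    and "((\<lambda>y. \<zeta> (t, y, u)) has_derivative (\<lambda>k. \<Sum>i\<in>UNIV. k $ i *\<^sub>R grad_x \<zeta> (t, x, u) $ i)) (at x)"
    and "pd_t I \<zeta> (t, x, u) = partial_within (closure I \<times> UNIV) (1, 0, 0) \<zeta> (t, x, u)"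
    and "pd_u \<zeta> (t, x, u) = partial_within (closure I \<times> UNIV) (0, 0, 1) \<zeta> (t, x, u)"
    and "grad_x \<zeta> (t, x, u) $ i = partial_within (closure I \<times> UNIV) (0, axis i 1, 0) \<zeta> (t, x, u)"
proof -
  define D where "D = frechet_derivative \<zeta> (at (t, x, u) within closure I \<times> UNIV)"
  have D: "(\<zeta> has_derivative D) (at (t, x, u) within closure I \<times> UNIV)"
    unfolding D_def using C1 t
    by (auto simp: C1_on_def differentiable_on_def frechet_derivative_works)
  have pw: "partial_within (closure I \<times> UNIV) b \<zeta> (t, x, u) = D b" for b
    by (simp add: partial_within_def D_def)
  have nb: "at t within closure I \<noteq> bot"
    using time_interval_facts(7)[OF I t] by (simp add: trivial_limit_within)
  have dt: "((\<lambda>s. \<zeta> (s, x, u)) has_vector_derivative D (1, 0, 0)) (at t within closure I)"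
    using has_vector_derivative_time_section[OF D] by (simp add: zero_prod_def)
  then show pt: "pd_t I \<zeta> (t, x, u) = partial_within (closure I \<times> UNIV) (1, 0, 0) \<zeta> (t, x, u)"
    using vector_derivative_within[OF nb dt] by (simp add: pd_t_def pw)
  show "((\<lambda>s. \<zeta> (s, x, u)) has_vector_derivative pd_t I \<zeta> (t, x, u)) (at t within closure I)"
    using dt by (simp add: pt pw)
  have z: "((\<lambda>z. \<zeta> (t, z)) has_derivative (\<lambda>k. D (0, k))) (at (x, u) within UNIV \<times> UNIV)"
    using has_derivative_space_section[OF D t] by simp
  have lin: "linear D" using D by (rule has_derivative_linear)
  have du: "((\<lambda>v. \<zeta> (t, x, v)) has_vector_derivative D (0, 0, 1)) (at u)"
  proof -
    have "((\<lambda>v. (x, v)) has_derivative (\<lambda>v. (0, v))) (at u)"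
      by (intro derivative_eq_intros) auto
    then have "((\<lambda>v. \<zeta> (t, x, v)) has_derivative (\<lambda>v. D (0, 0, v))) (at u)"
      by (rule has_derivative_compose) (use z in simp)
    moreover have "(\<lambda>v. D (0, 0, v)) = (\<lambda>v. v *\<^sub>R D (0, 0, 1))"
    proof
      fix v show "D (0, 0, v) = v *\<^sub>R D (0, 0, 1)"
        using linear_scale[OF lin, of v "(0, 0, 1)"] by simp
    qed
    ultimately show ?thesis by (simp only: has_vector_derivative_def)
  qed
  then show pu: "pd_u \<zeta> (t, x, u) = partial_within (closure I \<times> UNIV) (0, 0, 1) \<zeta> (t, x, u)"
    using vector_derivative_at[OF du] by (simp add: pd_u_def pw)
  show "((\<lambda>v. \<zeta> (t, x, v)) has_vector_derivative pd_u \<zeta> (t, x, u)) (at u)"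
    using du by (simp add: pu pw)
  have dx: "((\<lambda>y. \<zeta> (t, y, u)) has_derivative (\<lambda>k. D (0, k, 0))) (at x)"
  proof -
    have "((\<lambda>y. (y, u)) has_derivative (\<lambda>k. (k, 0))) (at x)"
      by (intro derivative_eq_intros) auto
    then show ?thesis
      by (rule has_derivative_compose) (use z in simp)
  qed
  then have gx: "grad_x \<zeta> (t, x, u) $ i = D (0, axis i 1, 0)" for i
    using frechet_derivative_at[OF dx, symmetric] by (simp add: grad_x_def)
  then show "grad_x \<zeta> (t, x, u) $ i = partial_within (closure I \<times> UNIV) (0, axis i 1, 0) \<zeta> (t, x, u)"
    by (simp add: pw)
  have "D (0, k, 0) = (\<Sum>i\<in>UNIV. k $ i *\<^sub>R grad_x \<zeta> (t, x, u) $ i)" for k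
    using linear_vec_expansion[OF has_derivative_linear[OF dx], of k] by (simp add: gx)
  with dx show "((\<lambda>y. \<zeta> (t, y, u)) has_derivative
      (\<lambda>k. \<Sum>i\<in>UNIV. k $ i *\<^sub>R grad_x \<zeta> (t, x, u) $ i)) (at x)"
    by simp
qed

lemma C1_on_continuous:
  fixes \<zeta> :: "real \<times> (real^'n) \<times> real \<Rightarrow> 'b::real_normed_vector"
  assumes I: "time_interval I" and C1: "C1_on (closure I \<times> UNIV) \<zeta>"
  shows "continuous_on (closure I \<times> UNIV) \<zeta>" "continuous_on (closure I \<times> UNIV) (pd_t I \<zeta>)"
    "continuous_on (closure I \<times> UNIV) (pd_u \<zeta>)" "continuous_on (closure I \<times> UNIV) (grad_x \<zeta>)"
proof -
  show "continuous_on (closure I \<times> UNIV) \<zeta>"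
    using C1 by (auto simp: C1_on_def differentiable_imp_continuous_on)
  have pw: "continuous_on (closure I \<times> UNIV) (partial_within (closure I \<times> UNIV) b \<zeta>)"
    if "b \<in> Basis" for b
    using C1 that by (auto simp: C1_on_def)
  show "continuous_on (closure I \<times> UNIV) (pd_t I \<zeta>)"
    by (rule continuous_on_eq[OF pw[of "(1, 0, 0)"]])
      (auto simp: Basis_prod_def zero_prod_def C1_on_sections(4)[OF I C1])
  show "continuous_on (closure I \<times> UNIV) (pd_u \<zeta>)"
    by (rule continuous_on_eq[OF pw[of "(0, 0, 1)"]])
      (auto simp: Basis_prod_def zero_prod_def C1_on_sections(5)[OF I C1])
  have "continuous_on (closure I \<times> UNIV) (\<lambda>p. grad_x \<zeta> p $ i)" for i
    by (rule continuous_on_eq[OF pw[of "(0, axis i 1, 0)"]])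
      (auto simp: Basis_prod_def zero_prod_def C1_on_sections(6)[OF I C1] Basis_vec_def)
  then have "continuous_on (closure I \<times> UNIV) (\<lambda>p. \<chi> i. grad_x \<zeta> p $ i)"
    by (rule continuous_on_vec_lambda)
  then show "continuous_on (closure I \<times> UNIV) (grad_x \<zeta>)"
    by (simp add: vec_lambda_eta)
qed

lemma flux_space_iff:
  fixes \<zeta> :: "real \<times> (real^'n) \<times> real \<Rightarrow> 'b::real_normed_vector"
  shows "\<zeta> \<in> flux_space I \<longleftrightarrow> C1_on (closure I \<times> UNIV) \<zeta> \<and>
     (\<forall>t\<in>closure I. \<forall>x u.
        (\<lambda>s. pd_u \<zeta> (s, x, u)) differentiable (at t within closure I) \<and>
        (\<lambda>y. pd_u \<zeta> (t, y, u)) differentiable (at x)) \<and>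
     continuous_on (closure I \<times> UNIV) (pd_t I (pd_u \<zeta>)) \<and>
     continuous_on (closure I \<times> UNIV) (grad_x (pd_u \<zeta>))"
  by (simp add: flux_space_def)

lemma flux_space_pd_u_sections:
  fixes \<zeta> :: "real \<times> (real^'n) \<times> real \<Rightarrow> 'b::real_normed_vector"
  assumes \<zeta>: "\<zeta> \<in> flux_space I" and t: "t \<in> closure I"
  shows "((\<lambda>s. pd_u \<zeta> (s, x, u)) has_vector_derivative pd_t I (pd_u \<zeta>) (t, x, u)) (at t within closure I)"
    and "((\<lambda>y. pd_u \<zeta> (t, y, u)) has_derivative (\<lambda>k. \<Sum>i\<in>UNIV. k $ i *\<^sub>R grad_x (pd_u \<zeta>) (t, x, u) $ i)) (at x)"
proof -
  show "((\<lambda>s. pd_u \<zeta> (s, x, u)) has_vector_derivative pd_t I (pd_u \<zeta>) (t, x, u)) (at t within closure I)"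
    using \<zeta> t by (auto simp: flux_space_iff pd_t_def simp flip: vector_derivative_works)
  have d: "((\<lambda>y. pd_u \<zeta> (t, y, u)) has_derivative frechet_derivative (\<lambda>y. pd_u \<zeta> (t, y, u)) (at x)) (at x)"
    using \<zeta> t by (auto simp: flux_space_iff frechet_derivative_works)
  have "frechet_derivative (\<lambda>y. pd_u \<zeta> (t, y, u)) (at x)
      = (\<lambda>k. \<Sum>i\<in>UNIV. k $ i *\<^sub>R grad_x (pd_u \<zeta>) (t, x, u) $ i)"
  proof
    fix k show "frechet_derivative (\<lambda>y. pd_u \<zeta> (t, y, u)) (at x) k
        = (\<Sum>i\<in>UNIV. k $ i *\<^sub>R grad_x (pd_u \<zeta>) (t, x, u) $ i)"
      using linear_vec_expansion[OF has_derivative_linear[OF d], of k] by (simp add: grad_x_def)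
  qed
  with d show "((\<lambda>y. pd_u \<zeta> (t, y, u)) has_derivative
      (\<lambda>k. \<Sum>i\<in>UNIV. k $ i *\<^sub>R grad_x (pd_u \<zeta>) (t, x, u) $ i)) (at x)"
    by simp
qed

section \<open>Primitives in the state variable\<close>

text \<open>
This is \<open>\<integral>\<^sub>0\<^sup>u a(t,x,w) dw\<close> after the substitution \<open>w = s u\<close>. The fixed interval of integration makes
negative \<open>u\<close> no special case and leaves \<open>(t,x,u)\<close> as parameters of the integrand only.
\<close>

definition u_primitive ::
  "(real \<times> (real^'n) \<times> real \<Rightarrow> 'b::banach) \<Rightarrow> real \<times> (real^'n) \<times> real \<Rightarrow> 'b" where
  "u_primitive a = (\<lambda>(t, x, u). u *\<^sub>R integral {0..1} (\<lambda>s. a (t, x, s * u)))"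

lemma u_primitive_at_0: "u_primitive a (t, x, 0) = 0"
  by (simp add: u_primitive_def)

lemma continuous_on_u_section:
  assumes "continuous_on (J \<times> UNIV) a" "t \<in> J"
  shows "continuous_on T (\<lambda>v. a (t, x, v))"
  by (rule continuous_on_compose2[OF assms(1)]) (use assms(2) in \<open>auto intro!: continuous_intros\<close>)

lemma integrable_u_section:
  fixes a :: "real \<times> (real^'n) \<times> real \<Rightarrow> 'b::banach"
  assumes "continuous_on (J \<times> UNIV) a" "t \<in> J"
  shows "(\<lambda>s. a (t, x, s * u)) integrable_on {0..1}"
  by (intro integrable_continuous_interval continuous_on_compose2[OF continuous_on_u_section[OF assms]])
    (auto intro!: continuous_intros)

lemma continuous_on_u_primitive:
  fixes a :: "real \<times> (real^'n) \<times> real \<Rightarrow> 'b::banach"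
  assumes a: "continuous_on (J \<times> UNIV) a"
  shows "continuous_on (J \<times> UNIV) (u_primitive a)"
proof -
  have "continuous_on ((J \<times> UNIV) \<times> cbox 0 1) (\<lambda>(p, s). a (fst p, fst (snd p), s * snd (snd p)))"
    unfolding split_beta
    by (rule continuous_on_compose2[OF a]) (auto intro!: continuous_intros)
  then have "continuous_on (J \<times> UNIV) (\<lambda>p. integral (cbox 0 1) (\<lambda>s. a (fst p, fst (snd p), s * snd (snd p))))"
    by (rule integral_continuous_on_param)
  then show ?thesis
    unfolding u_primitive_def split_beta by (auto intro!: continuous_intros)
qed

text \<open>
The integrand is only continuous in \<open>u\<close>, so the formula cannot be differentiated under the
integral sign. Instead, the chain rule for an antiderivative \<open>A\<close> of \<open>a(t,x,\<cdot>)\<close> shows that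
\<open>u \<integral>\<^sub>0\<^sup>1 a(t,x,s u) ds = A(u) - A(0)\<close>.
\<close>

lemma u_primitive_has_vector_derivative:
  fixes a :: "real \<times> (real^'n) \<times> real \<Rightarrow> 'b::banach"
  assumes a: "continuous_on UNIV (\<lambda>v. a (t, x, v))"
  shows "((\<lambda>v. u_primitive a (t, x, v)) has_vector_derivative a (t, x, u)) (at u)"
proof -
  \<comment> \<open>The derivative at \<open>u\<close> is two-sided, so \<open>u\<close> has to be interior to \<open>[-R, R]\<close>.\<close>
  define R where "R = \<bar>u\<bar> + 1"
  obtain A where A: "\<And>v. v \<in> {-R..R} \<Longrightarrow> (A has_vector_derivative a (t, x, v)) (at v within {-R..R})"
    using antiderivative_continuous[OF continuous_on_subset[OF a subset_UNIV]] by metis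
  have eq: "u_primitive a (t, x, v) = A v - A 0" if v: "v \<in> {-R..R}" for v
  proof -
    have "((\<lambda>s. v *\<^sub>R a (t, x, s * v)) has_integral A (1 * v) - A (0 * v)) {0..1}"
    proof (rule fundamental_theorem_of_calculus)
      fix s :: real assume s: "s \<in> {0..1}"
      have sub: "(\<lambda>s. s * v) ` {0..1} \<subseteq> {-R..R}"
      proof clarify
        fix r :: real assume "r \<in> {0..1}"
        then have "\<bar>r * v\<bar> \<le> 1 * \<bar>v\<bar>" unfolding abs_mult by (intro mult_right_mono) auto
        then show "r * v \<in> {-R..R}" using v by (auto simp: abs_le_iff)
      qed
      have d: "((\<lambda>s. s * v) has_vector_derivative v) (at s within {0..1})"
        by (auto intro!: derivative_eq_intros)
      have "(A has_vector_derivative a (t, x, s * v)) (at (s * v) within (\<lambda>s. s * v) ` {0..1})"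
        using sub s by (intro has_vector_derivative_within_subset[OF A sub]) blast
      from vector_diff_chain_within[OF d this]
      show "((\<lambda>s. A (s * v)) has_vector_derivative v *\<^sub>R a (t, x, s * v)) (at s within {0..1})"
        by (simp add: o_def)
    qed simp
    from integral_unique[OF this] show ?thesis by (simp add: u_primitive_def)
  qed
  have u: "u \<in> {-R<..<R}" by (auto simp: R_def)
  have "((\<lambda>v. A v - A 0) has_vector_derivative a (t, x, u)) (at u within {-R..R})"
    using A[of u] u by (auto intro!: derivative_eq_intros)
  then have "((\<lambda>v. A v - A 0) has_vector_derivative a (t, x, u)) (at u)"
    using u by (subst (asm) at_within_interior) auto
  then show ?thesis
    by (rule has_vector_derivative_transform_within_open[where S = "{-R<..<R}"])
      (use u eq in auto)
qed

text \<open>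
The linear form with partial derivative \<open>c\<close> in \<open>t\<close> and \<open>d $ i\<close> in \<open>x\<^sub>i\<close>, bundled as a bounded linear
function because continuity of derivatives is measured in the operator norm.
\<close>

definition gradient_blinfun :: "'b::euclidean_space \<Rightarrow> 'b^'n \<Rightarrow> (real \<times> (real^'n)) \<Rightarrow>\<^sub>L 'b" where
  "gradient_blinfun c d = Blinfun (\<lambda>k. fst k *\<^sub>R c + (\<Sum>i\<in>UNIV. snd k $ i *\<^sub>R d $ i))"

lemma gradient_blinfun_apply:
  fixes c :: "'b::euclidean_space" and d :: "'b^'n"
  shows "blinfun_apply (gradient_blinfun c d) k = fst k *\<^sub>R c + (\<Sum>i\<in>UNIV. snd k $ i *\<^sub>R d $ i)"
proof -
  have "bounded_linear (\<lambda>k :: real \<times> (real^'n). fst k *\<^sub>R c + (\<Sum>i\<in>UNIV. snd k $ i *\<^sub>R d $ i))"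
    by (intro bounded_linear_intros bounded_linear_compose[OF bounded_linear_vec_nth])
  then show ?thesis
    by (simp add: gradient_blinfun_def bounded_linear_Blinfun_apply)
qed

lemma continuous_on_gradient_blinfun:
  fixes c :: "'z::t2_space \<Rightarrow> 'b::euclidean_space" and d :: "'z \<Rightarrow> 'b^'n"
  assumes "continuous_on S c" "continuous_on S d"
  shows "continuous_on S (\<lambda>p. gradient_blinfun (c p) (d p))"
  by (intro continuous_on_blinfun_componentwise)
    (auto simp: gradient_blinfun_apply intro!: continuous_intros assms)

text \<open>
For total differentiability it suffices that one of the two partial derivatives, here the one in
\<open>x\<close>, is continuous.
\<close>

lemma has_derivative_time_space:
  fixes a :: "real \<times> (real^'n) \<Rightarrow> 'b::euclidean_space"
  assumes t: "t \<in> J"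
    and dt: "((\<lambda>s. a (s, x)) has_vector_derivative a_t) (at t within J)"
    and dx: "\<And>t x. t \<in> J \<Longrightarrow> ((\<lambda>y. a (t, y)) has_derivative (\<lambda>k. \<Sum>i\<in>UNIV. k $ i *\<^sub>R a_x (t, x) $ i)) (at x)"
    and cont: "continuous_on (J \<times> UNIV) a_x"
  shows "(a has_derivative gradient_blinfun a_t (a_x (t, x))) (at (t, x) within J \<times> UNIV)"
proof -
  \<comment> \<open>The derivative in \<open>x\<close> alone, as a bounded linear function.\<close>
  define P :: "'b^'n \<Rightarrow> (real^'n) \<Rightarrow>\<^sub>L 'b" where
    "P d = gradient_blinfun 0 d o\<^sub>L Blinfun (Pair 0)" for d
  have PB: "blinfun_apply (Blinfun (Pair (0::real))) k = (0, k :: real^'n)" for k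
    by (subst bounded_linear_Blinfun_apply) (auto intro: bounded_linear_Pair bounded_linear_zero bounded_linear_ident)
  have P: "blinfun_apply (P d) = (\<lambda>k. \<Sum>i\<in>UNIV. k $ i *\<^sub>R d $ i)" for d
    by (simp add: P_def gradient_blinfun_apply PB fun_eq_iff)
  have "continuous_on (J \<times> UNIV) (\<lambda>p. P (a_x p))"
    by (intro continuous_on_blinfun_componentwise) (auto simp: P intro!: continuous_intros cont)
  then have c: "continuous (at (t, x) within J \<times> UNIV) (\<lambda>(t, x). P (a_x (t, x)))"
    unfolding case_prod_beta' prod.collapse
    using t by (auto simp: continuous_on_eq_continuous_within)
  have "((\<lambda>(t, x). a (t, x)) has_derivative (\<lambda>(\<tau>, \<xi>). \<tau> *\<^sub>R a_t + blinfun_apply (P (a_x (t, x))) \<xi>))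
      (at (t, x) within J \<times> UNIV)"
    by (rule has_derivative_partialsI[OF _ _ c])
      (use dt dx in \<open>auto simp: has_vector_derivative_def P\<close>)
  then show ?thesis
    by (simp add: P gradient_blinfun_apply[abs_def] case_prod_beta')
qed

text \<open>
In \<open>(t,x)\<close> the derivative is taken under the integral sign, in \<open>u\<close> it is the integrand. Since the
latter is continuous, the two partial derivatives combine to the derivative on the slab.
\<close>

lemma u_primitive_has_derivative:
  fixes a :: "real \<times> (real^'n) \<times> real \<Rightarrow> 'b::euclidean_space"
  assumes J: "convex J"
    and a: "continuous_on (J \<times> UNIV) a" and a_t: "continuous_on (J \<times> UNIV) a_t"
    and a_x: "continuous_on (J \<times> UNIV) a_x"
    and dt: "\<And>t x u. t \<in> J \<Longrightarrow>
        ((\<lambda>s. a (s, x, u)) has_vector_derivative a_t (t, x, u)) (at t within J)"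
    and dx: "\<And>t x u. t \<in> J \<Longrightarrow>
        ((\<lambda>y. a (t, y, u)) has_derivative (\<lambda>k. \<Sum>i\<in>UNIV. k $ i *\<^sub>R a_x (t, x, u) $ i)) (at x)"
    and t: "t \<in> J"
  shows "(u_primitive a has_derivative
      (\<lambda>(\<tau>, \<xi>, \<upsilon>). \<tau> *\<^sub>R u_primitive a_t (t, x, u)
         + (\<Sum>i\<in>UNIV. \<xi> $ i *\<^sub>R u_primitive a_x (t, x, u) $ i) + \<upsilon> *\<^sub>R a (t, x, u)))
      (at (t, x, u) within J \<times> UNIV)"
proof -
  let ?z = "\<lambda>z v. (fst z, snd z, v) :: real \<times> (real^'n) \<times> real"
  define L where "L = (\<lambda>z s. gradient_blinfun (a_t (?z z (s * u))) (a_x (?z z (s * u))))"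
  have tx: "(t, x) \<in> J \<times> UNIV" using t by simp
  have cL: "continuous_on ((J \<times> UNIV) \<times> cbox 0 1) (\<lambda>(z, s). L z s)"
    unfolding L_def split_beta
    by (intro continuous_on_gradient_blinfun continuous_on_compose2[OF a_t]
        continuous_on_compose2[OF a_x]) (auto intro!: continuous_intros)
  have Lint: "L (t, x) integrable_on cbox 0 1"
    by (rule integrable_continuous, rule continuous_on_compose2[OF cL, of _ "\<lambda>s. ((t, x), s)", simplified])
      (use t in \<open>auto intro!: continuous_intros\<close>)
  have "((\<lambda>z. integral (cbox 0 1) (\<lambda>s. a (?z z (s * u))))
      has_derivative blinfun_apply (integral (cbox 0 1) (L (t, x)))) (at (t, x) within J \<times> UNIV)"
  proof (rule leibniz_rule[OF _ _ cL tx])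
    fix z :: "real \<times> (real^'n)" and s :: real assume z: "z \<in> J \<times> UNIV"
    then show "(\<lambda>s. a (?z z (s * u))) integrable_on cbox 0 1"
      using integrable_u_section[OF a, of "fst z" "snd z" u] by auto
    have "((\<lambda>z. a (?z z (s * u))) has_derivative L (fst z, snd z)s)
      (at (fst z, snd z) within J \<times> UNIV)"
      unfolding L_def fst_conv snd_conv
      by (rule has_derivative_time_space[where a_x = "\<lambda>z. a_x (?z z (s * u))", simplified])
        (use z dt dx in \<open>auto intro!: continuous_intros continuous_on_compose2[OF a_x]\<close>)
    then show "((\<lambda>z. a (?z z (s * u))) has_derivative L z s) (at z within J \<times> UNIV)"
      by simp
  qed (use J in \<open>auto intro: convex_Times\<close>)
  then have dz: "((\<lambda>z. u_primitive a (?z z u)) has_derivative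
      (\<lambda>k. u *\<^sub>R blinfun_apply (integral (cbox 0 1) (L (t, x))) k)) (at (t, x) within J \<times> UNIV)"
    unfolding u_primitive_def by (auto intro!: derivative_eq_intros)
  have Lk: "u *\<^sub>R blinfun_apply (integral (cbox 0 1) (L (t, x))) k
      = fst k *\<^sub>R u_primitive a_t (t, x, u) + (\<Sum>i\<in>UNIV. snd k $ i *\<^sub>R u_primitive a_x (t, x, u) $ i)"
    for k
  proof -
    note it = integrable_u_section[OF a_t t, of x u]
    note ix = integrable_u_section[OF a_x t, of x u]
    have nth: "((\<lambda>s. a_x (t, x, s * u) $ i) has_integral integral {0..1} (\<lambda>s. a_x (t, x, s * u)) $ i) {0..1}"
      for i
      using has_integral_linear[OF integrable_integral[OF ix] bounded_linear_vec_nth[of i]]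
      by (simp add: o_def)
    have "blinfun_apply (integral (cbox 0 1) (L (t, x))) k
        = integral (cbox 0 1) (\<lambda>s. blinfun_apply (L (t, x) s) k)"
      by (rule blinfun_apply_integral[OF Lint])
    also have "\<dots> = fst k *\<^sub>R integral {0..1} (\<lambda>s. a_t (t, x, s * u))
        + (\<Sum>i\<in>UNIV. snd k $ i *\<^sub>R integral {0..1} (\<lambda>s. a_x (t, x, s * u)) $ i)"
      unfolding L_def gradient_blinfun_apply fst_conv snd_conv box_real
      by (intro integral_unique has_integral_add has_integral_cmul has_integral_sum
          integrable_integral it nth) auto
    finally show ?thesis
      by (simp add: u_primitive_def scaleR_add_right scaleR_sum_right scaleR_left_commute mult.commute)
  qed
  have c: "continuous (at ((t, x), u) within (J \<times> UNIV) \<times> UNIV)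
      (\<lambda>(z, v). blinfun_scaleR_left (a (?z z v)))"
  proof -
    have "continuous_on ((J \<times> UNIV) \<times> UNIV) (\<lambda>(z, v). blinfun_scaleR_left (a (?z z v)))"
      unfolding split_beta
      by (intro bounded_linear.continuous_on[OF bounded_linear_blinfun_scaleR_left]
          continuous_on_compose2[OF a]) (auto intro!: continuous_intros)
    then show ?thesis using tx unfolding continuous_on_eq_continuous_within by blast
  qed
  \<comment> \<open>Here \<open>z = (t,x)\<close> is one block of variables and \<open>v\<close> the other.\<close>
  have "((\<lambda>(z, v). u_primitive a (?z z v)) has_derivative
      (\<lambda>(k, \<upsilon>). u *\<^sub>R blinfun_apply (integral (cbox 0 1) (L (t, x))) k
         + blinfun_apply (blinfun_scaleR_left (a (?z (t, x) u))) \<upsilon>))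
      (at ((t, x), u) within (J \<times> UNIV) \<times> UNIV)"
  proof (rule has_derivative_partialsI[where f = "\<lambda>z v. u_primitive a (?z z v)", OF dz _ c])
    fix z :: "real \<times> (real^'n)" and v :: real assume z: "z \<in> J \<times> UNIV"
    then have "((\<lambda>v. u_primitive a (?z z v)) has_vector_derivative a (?z z v)) (at v)"
      by (intro u_primitive_has_vector_derivative continuous_on_u_section[OF a]) auto
    then show "((\<lambda>v. u_primitive a (?z z v)) has_derivative
        blinfun_apply (blinfun_scaleR_left (a (?z z v)))) (at v within UNIV)"
      by (simp add: has_vector_derivative_def blinfun_scaleR_left.rep_eq)
  qed auto
  then have D: "((\<lambda>(z, v). u_primitive a (?z z v)) has_derivative
      (\<lambda>(k, \<upsilon>). fst k *\<^sub>R u_primitive a_t (t, x, u)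
         + (\<Sum>i\<in>UNIV. snd k $ i *\<^sub>R u_primitive a_x (t, x, u) $ i) + \<upsilon> *\<^sub>R a (t, x, u)))
      (at ((t, x), u) within (J \<times> UNIV) \<times> UNIV)"
    unfolding Lk by (simp add: blinfun_scaleR_left.rep_eq)
  \<comment> \<open>It remains to re-associate \<open>((t,x),u)\<close> to \<open>(t,x,u)\<close>.\<close>
  have R: "((\<lambda>p. ((fst p, fst (snd p)), snd (snd p))) has_derivative
      (\<lambda>p. ((fst p, fst (snd p)), snd (snd p)))) (at (t, x, u) within J \<times> UNIV)"
    by (auto intro!: derivative_eq_intros)
  from has_derivative_in_compose[OF R, OF has_derivative_subset, of _ _ "(J \<times> UNIV) \<times> UNIV", simplified fst_conv snd_conv, OF D]
  show ?thesis
    by (simp add: case_prod_beta' image_subset_iff)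
qed

text \<open>
The set \<open>K \<times> [-C, C]\<close>, re-associated so that it consists of triples \<open>(t, x, u)\<close>.
\<close>

definition cylinder :: "(real \<times> (real^'n)) set \<Rightarrow> real \<Rightarrow> (real \<times> (real^'n) \<times> real) set" where
  "cylinder K C = (\<lambda>(p, u). (fst p, snd p, u)) ` (K \<times> {-C..C})"

lemma in_cylinder_iff: "(t, x, u) \<in> cylinder K C \<longleftrightarrow> (t, x) \<in> K \<and> \<bar>u\<bar> \<le> C"
  by (force simp: cylinder_def abs_le_iff intro: rev_image_eqI)

lemma compact_cylinder: "compact K \<Longrightarrow> compact (cylinder K C)"
  unfolding cylinder_def
  by (intro compact_continuous_image compact_Times) (auto simp: split_beta intro!: continuous_intros)

text \<open>
Cylinders are star-shaped in \<open>u\<close> about \<open>u = 0\<close>, so the points \<open>(t, x, s u)\<close> with \<open>0 \<le> s \<le> 1\<close> stay in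
the set on which the integrands converge uniformly.
\<close>

lemma uniform_limit_u_primitive:
  fixes a :: "real \<times> (real^'n) \<times> real \<Rightarrow> 'b::banach"
  assumes lim: "uniform_limit (cylinder K C) as a sequentially"
    and KJ: "K \<subseteq> J \<times> UNIV"
    and a: "continuous_on (J \<times> UNIV) a" and as: "\<And>n. continuous_on (J \<times> UNIV) (as n)"
  shows "uniform_limit (cylinder K C) (\<lambda>n. u_primitive (as n)) (u_primitive a) sequentially"
proof (rule uniform_limitI)
  fix e :: real assume e: "e > 0"
  define d where "d = e / (2 * (\<bar>C\<bar> + 1))"
  have d: "d > 0" using e by (simp add: d_def)
  from uniform_limitD[OF lim d]
  show "\<forall>\<^sub>F n in sequentially. \<forall>p\<in>cylinder K C. dist (u_primitive (as n) p) (u_primitive a p) < e"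
  proof eventually_elim
    case (elim n)
    show ?case
    proof
      fix p assume p: "p \<in> cylinder K C"
      obtain t x u where ptx: "p = (t, x, u)" by (metis prod_cases3)
      have K: "(t, x) \<in> K" "\<bar>u\<bar> \<le> C" using p by (auto simp: ptx in_cylinder_iff)
      then have t: "t \<in> J" using KJ by auto
      note ia = integrable_u_section[OF a t, of x u] integrable_u_section[OF as t, of n x u]
      have "norm (integral {0..1} (\<lambda>s. as n (t, x, s * u) - a (t, x, s * u)))
          \<le> integral {0..1} (\<lambda>s::real. d)"
      proof (rule integral_norm_bound_integral)
        fix s :: real assume s: "s \<in> {0..1}"
        then have "\<bar>s * u\<bar> \<le> 1 * \<bar>u\<bar>" unfolding abs_mult by (intro mult_right_mono) auto
        then have "(t, x, s * u) \<in> cylinder K C" using K by (simp add: in_cylinder_iff)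
        then show "norm (as n (t, x, s * u) - a (t, x, s * u)) \<le> d"
          using elim by (auto simp: dist_norm intro: less_imp_le)
      qed (use ia in \<open>auto intro: integrable_diff\<close>)
      then have "norm (integral {0..1} (\<lambda>s. as n (t, x, s * u)) - integral {0..1} (\<lambda>s. a (t, x, s * u))) \<le> d"
        using ia by (simp add: integral_diff)
      then have "dist (u_primitive (as n) p) (u_primitive a p) \<le> \<bar>C\<bar> * d"
        using K d by (simp add: ptx u_primitive_def dist_norm flip: scaleR_diff_right)
          (intro mult_mono, auto)
      also have "\<dots> < e"
        using e by (simp add: d_def field_simps) (intro add_nonneg_pos, auto)
      finally show "dist (u_primitive (as n) p) (u_primitive a p) < e" .
    qed
  qed
qed

section \<open>The normalised entropy flux\<close>

lemma C1_differentiable_onD: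
  fixes E :: "real \<Rightarrow> real"
  assumes "E C1_differentiable_on UNIV"
  shows "continuous_on UNIV (deriv E)" "continuous_on UNIV E"
proof -
  obtain D where D: "\<And>x. (E has_vector_derivative D x) (at x)" "continuous_on UNIV D"
    using assms by (auto simp: C1_differentiable_on_def)
  have "deriv E = D"
    using D(1) by (auto simp: has_real_derivative_iff_has_vector_derivative[symmetric] intro!: DERIV_imp_deriv)
  with D(2) show "continuous_on UNIV (deriv E)" by simp
  show "continuous_on UNIV E"
    using C1_differentiable_imp_continuous_on[OF assms] .
qed

lemma flux_space_continuous:
  fixes \<zeta> :: "real \<times> (real^'n) \<times> real \<Rightarrow> 'b::real_normed_vector"
  assumes I: "time_interval I" and \<zeta>: "\<zeta> \<in> flux_space I"
  shows "continuous_on (closure I \<times> UNIV) \<zeta>" "continuous_on (closure I \<times> UNIV) (pd_t I \<zeta>)"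
    "continuous_on (closure I \<times> UNIV) (pd_u \<zeta>)" "continuous_on (closure I \<times> UNIV) (grad_x \<zeta>)"
    "continuous_on (closure I \<times> UNIV) (pd_t I (pd_u \<zeta>))"
    "continuous_on (closure I \<times> UNIV) (grad_x (pd_u \<zeta>))"
  using \<zeta> C1_on_continuous[OF I, of \<zeta>] by (auto simp: flux_space_iff)

lemma continuous_on_div_x:
  "continuous_on S (grad_x F) \<Longrightarrow> continuous_on S (div_x F)"
  unfolding div_x_def[abs_def] by (intro continuous_intros)

lemma pd_t_eqI:
  assumes "time_interval I" "t \<in> closure I"
    and "((\<lambda>s. \<zeta> (s, x, u)) has_vector_derivative d) (at t within closure I)"
  shows "pd_t I \<zeta> (t, x, u) = d"
  using vector_derivative_within[OF _ assms(3)] time_interval_facts(7)[OF assms(1,2)]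
  by (simp add: pd_t_def trivial_limit_within)

lemma grad_x_eqI:
  assumes "((\<lambda>y. \<zeta> (t, y, u)) has_derivative (\<lambda>k. \<Sum>i\<in>UNIV. k $ i *\<^sub>R d $ i)) (at x)"
  shows "grad_x \<zeta> (t, x, u) = d"
proof (unfold vec_eq_iff, intro allI)
  fix i
  have "grad_x \<zeta> (t, x, u) $ i = (\<Sum>j\<in>UNIV. axis i 1 $ j *\<^sub>R d $ j)"
    using frechet_derivative_at[OF assms, symmetric] by (simp add: grad_x_def)
  also have "\<dots> = (\<Sum>j\<in>UNIV. if j = i then d $ i else 0)"
    by (intro sum.cong) (auto simp: axis_def)
  finally show "grad_x \<zeta> (t, x, u) $ i = d $ i" by simp
qed

text \<open>
For \<open>h = \<partial>\<^sub>uf\<close> this is the \<open>u\<close>-derivative which an entropy flux is required to have.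
\<close>

definition deriv_weighted ::
  "(real \<Rightarrow> real) \<Rightarrow> (real \<times> (real^'n) \<times> real \<Rightarrow> 'b::real_normed_vector)
    \<Rightarrow> real \<times> (real^'n) \<times> real \<Rightarrow> 'b" where
  "deriv_weighted E h = (\<lambda>p. deriv E (snd (snd p)) *\<^sub>R h p)"

lemma continuous_on_deriv_weighted:
  assumes E: "E C1_differentiable_on UNIV" and h: "continuous_on S h"
  shows "continuous_on S (deriv_weighted E h)"
  unfolding deriv_weighted_def
  by (intro continuous_intros continuous_on_compose2[OF C1_differentiable_onD(1)[OF E]] h) auto

text \<open>
The entropy flux that vanishes at \<open>u = 0\<close>.
\<close>

definition normalised_flux ::
  "(real \<times> (real^'n) \<times> real \<Rightarrow> real^'n) \<Rightarrow> (real \<Rightarrow> real) \<Rightarrow> real \<times> (real^'n) \<times> real \<Rightarrow> real^'n" where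
  "normalised_flux f E = u_primitive (deriv_weighted E (pd_u f))"

text \<open>
Differentiating \<open>\<integral>\<^sub>0\<^sup>u E'(w) \<partial>\<^sub>uf dw\<close> in \<open>t\<close> and \<open>x\<close> produces the mixed derivatives \<open>\<partial>\<^sub>t\<partial>\<^sub>uf\<close> and \<open>\<nabla>\<^sub>x\<partial>\<^sub>uf\<close>.
Their continuity, which is part of the definition of the flux space, makes the result C1 and is
inherited by its mixed derivatives.
\<close>

lemma normalised_flux_properties:
  fixes f :: "real \<times> (real^'n) \<times> real \<Rightarrow> real^'n"
  assumes I: "time_interval I" and f: "f \<in> flux_space I" and E: "E C1_differentiable_on UNIV"
  shows entropy_flux_normalised: "entropy_flux I f E (normalised_flux f E)"
    and grad_x_normalised: "\<And>t x u. t \<in> closure I \<Longrightarrow> grad_x (normalised_flux f E) (t, x, u)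
        = u_primitive (deriv_weighted E (grad_x (pd_u f))) (t, x, u)"
proof -
  let ?J = "closure I" and ?G = "normalised_flux f E"
  define a where "a = deriv_weighted E (pd_u f)"
  define a_t where "a_t = deriv_weighted E (pd_t I (pd_u f))"
  define a_x where "a_x = deriv_weighted E (grad_x (pd_u f))"
  note fc = flux_space_continuous[OF I f]
  have ca: "continuous_on (?J \<times> UNIV) a" "continuous_on (?J \<times> UNIV) a_t" "continuous_on (?J \<times> UNIV) a_x"
    unfolding a_def a_t_def a_x_def using fc by (auto intro: continuous_on_deriv_weighted[OF E])
  have dt: "((\<lambda>s. a (s, x, u)) has_vector_derivative a_t (t, x, u)) (at t within ?J)"
    if "t \<in> ?J" for t x u
    using bounded_linear.has_vector_derivative[OF bounded_linear_scaleR_right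
        flux_space_pd_u_sections(1)[OF f that]]
    by (simp add: a_def a_t_def deriv_weighted_def)
  have dx: "((\<lambda>y. a (t, y, u)) has_derivative (\<lambda>k. \<Sum>i\<in>UNIV. k $ i *\<^sub>R a_x (t, x, u) $ i)) (at x)"
    if "t \<in> ?J" for t x u
    using has_derivative_scaleR_right[OF flux_space_pd_u_sections(2)[OF f that], of "deriv E u"]
    by (simp add: a_def a_x_def deriv_weighted_def scaleR_sum_right mult.commute)
  define D where "D = (\<lambda>p (\<tau>, \<xi>, \<upsilon>). \<tau> *\<^sub>R u_primitive a_t p
      + (\<Sum>i\<in>UNIV. \<xi> $ i *\<^sub>R u_primitive a_x p $ i) + \<upsilon> *\<^sub>R a p)"
  have D: "(?G has_derivative D p) (at p within ?J \<times> UNIV)" if "p \<in> ?J \<times> UNIV" for p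
  proof -
    obtain t x u where p: "p = (t, x, u)" "t \<in> ?J" using \<open>p \<in> ?J \<times> UNIV\<close> by (cases p rule: prod_cases3) auto
    show ?thesis
      using u_primitive_has_derivative[OF time_interval_facts(4)[OF I] ca dt dx p(2)]
      by (simp add: p(1) D_def normalised_flux_def a_def)
  qed
  have C1: "C1_on (?J \<times> UNIV) ?G"
  proof (rule C1_onI[OF time_interval_facts(7)[OF I] D])
    fix b :: "real \<times> (real^'n) \<times> real"
    show "continuous_on (?J \<times> UNIV) (\<lambda>p. D p b)"
      unfolding D_def split_beta
      by (intro continuous_intros continuous_on_u_primitive ca)
  qed
  have gx: "((\<lambda>y. ?G (t, y, u)) has_derivative
      (\<lambda>k. \<Sum>i\<in>UNIV. k $ i *\<^sub>R u_primitive a_x (t, x, u) $ i)) (at x)" if t: "t \<in> ?J" for t x u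
  proof -
    have z: "((\<lambda>z. ?G (t, z)) has_derivative (\<lambda>k. D (t, x, u) (0, k))) (at (x, u))"
      by (rule has_derivative_space_section[OF D t]) (use t in auto)
    have y: "((\<lambda>y. (y, u)) has_derivative (\<lambda>k. (k, 0))) (at x)"
      by (intro derivative_eq_intros) auto
    from has_derivative_compose[OF y z] show ?thesis by (simp add: D_def)
  qed
  show "grad_x ?G (t, x, u) = u_primitive (deriv_weighted E (grad_x (pd_u f))) (t, x, u)"
    if "t \<in> ?J" for t x u
    using grad_x_eqI[OF gx[OF that]] by (simp add: a_x_def)
  have pu: "pd_u ?G (t, x, u) = a (t, x, u)" if "t \<in> ?J" for t x u
    using vector_derivative_at[OF u_primitive_has_vector_derivative[OF continuous_on_u_section[OF ca(1) that]]]
    by (simp add: pd_u_def normalised_flux_def a_def)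
  have put: "((\<lambda>s. pd_u ?G (s, x, u)) has_vector_derivative a_t (t, x, u)) (at t within ?J)"
    if "t \<in> ?J" for t x u
    by (rule has_vector_derivative_transform[OF that _ dt[OF that]]) (rule pu)
  have pux: "((\<lambda>y. pd_u ?G (t, y, u)) has_derivative (\<lambda>k. \<Sum>i\<in>UNIV. k $ i *\<^sub>R a_x (t, x, u) $ i)) (at x)"
    if "t \<in> ?J" for t x u
    unfolding pu[OF that] by (rule dx[OF that])
  have "?G \<in> flux_space I"
    unfolding flux_space_iff
  proof (intro conjI ballI allI C1)
    show "continuous_on (?J \<times> UNIV) (pd_t I (pd_u ?G))"
      by (rule continuous_on_eq[OF ca(2)]) (auto simp: pd_t_eqI[OF I _ put])
    show "continuous_on (?J \<times> UNIV) (grad_x (pd_u ?G))"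
      by (rule continuous_on_eq[OF ca(3)]) (auto simp: grad_x_eqI[OF pux])
  qed (auto intro: differentiableI_vector[OF put] differentiableI[OF pux])
  then show "entropy_flux I f E ?G"
    by (simp add: entropy_flux_def pu a_def deriv_weighted_def)
qed

text \<open>
Two entropy fluxes have the same \<open>u\<close>-derivative, so their difference does not depend on \<open>u\<close>, and
the normalised flux is zero at \<open>u = 0\<close>.
\<close>

lemma entropy_flux_unique:
  fixes f :: "real \<times> (real^'n) \<times> real \<Rightarrow> real^'n"
  assumes I: "time_interval I" and f: "f \<in> flux_space I" and E: "E C1_differentiable_on UNIV"
    and F: "entropy_flux I f E F" and t: "t \<in> closure I"
  shows "F (t, x, u) = normalised_flux f E (t, x, u) + F (t, x, 0)"
    and "div_x F (t, x, u) = div_x (normalised_flux f E) (t, x, u) + div_x F (t, x, 0)"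
proof -
  let ?G = "normalised_flux f E"
  note G = entropy_flux_normalised[OF I f E]
  have C1: "C1_on (closure I \<times> UNIV) F" "C1_on (closure I \<times> UNIV) ?G"
    using F G by (auto simp: entropy_flux_def flux_space_iff)
  have eq: "F (t, x, u) = ?G (t, x, u) + F (t, x, 0)" for x u
  proof -
    have "((\<lambda>v. F (t, x, v) - ?G (t, x, v)) has_vector_derivative 0) (at v)" for v :: real
      using has_vector_derivative_diff[OF C1_on_sections(2)[OF I C1(1) t, of x v] C1_on_sections(2)[OF I C1(2) t, of x v]]
        F G t by (auto simp: entropy_flux_def)
    then have "\<exists>c. \<forall>v\<in>UNIV. F (t, x, v) - ?G (t, x, v) = c"
      by (intro has_derivative_zero_constant) (auto simp: has_vector_derivative_def)
    then obtain c where "\<And>v. F (t, x, v) - ?G (t, x, v) = c" by auto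
    from this[of u] this[of 0] show ?thesis
      by (simp add: normalised_flux_def u_primitive_at_0 algebra_simps)
  qed
  show "F (t, x, u) = ?G (t, x, u) + F (t, x, 0)" by (rule eq)
  have "((\<lambda>y. F (t, y, u)) has_derivative
      (\<lambda>k. \<Sum>i\<in>UNIV. k $ i *\<^sub>R (grad_x ?G (t, x, u) + grad_x F (t, x, 0)) $ i)) (at x)"
    using has_derivative_add[OF C1_on_sections(3)[OF I C1(2) t, of u x] C1_on_sections(3)[OF I C1(1) t, of 0 x]]
    unfolding eq[of _ u] by (simp add: sum.distrib scaleR_add_right)
  from grad_x_eqI[OF this]
  show "div_x F (t, x, u) = div_x ?G (t, x, u) + div_x F (t, x, 0)"
    by (simp add: div_x_def sum.distrib)
qed

section \<open>Convergence of fluxes\<close>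

lemma norm_le_sup_norm_on:
  assumes "compact K" "continuous_on K h" "p \<in> K"
  shows "norm (h p) \<le> sup_norm_on K h"
proof -
  have "bdd_above ((\<lambda>p. norm (h p)) ` K)"
    using assms(1,2) by (intro bounded_imp_bdd_above compact_imp_bounded compact_continuous_image
        continuous_on_norm)
  then show ?thesis
    using assms(3) by (auto simp: sup_norm_on_def intro: cSUP_upper)
qed

lemma sup_norm_on_nonneg:
  assumes "compact K" "continuous_on K h"
  shows "0 \<le> sup_norm_on K h"
proof (cases "K = {}")
  case False
  then obtain p where "p \<in> K" by blast
  from order_trans[OF norm_ge_zero norm_le_sup_norm_on[OF assms this]] show ?thesis .
qed (simp add: sup_norm_on_def)

lemma C1_on_diff:
  fixes h k :: "real \<times> 'c::euclidean_space \<Rightarrow> 'b::real_normed_vector"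
  assumes J: "\<And>t. t \<in> J \<Longrightarrow> t islimpt J"
    and h: "C1_on (J \<times> UNIV) h" and k: "C1_on (J \<times> UNIV) k"
  shows "C1_on (J \<times> UNIV) (\<lambda>p. h p - k p)"
proof (rule C1_onI[OF J])
  fix p assume "p \<in> J \<times> (UNIV :: 'c set)"
  then show "((\<lambda>p. h p - k p) has_derivative
      (\<lambda>b. partial_within (J \<times> UNIV) b h p - partial_within (J \<times> UNIV) b k p)) (at p within J \<times> UNIV)"
    using h k unfolding partial_within_def C1_on_def differentiable_on_def
    by (intro has_derivative_diff) (auto simp flip: frechet_derivative_works)
next
  fix b :: "real \<times> 'c" assume "b \<in> Basis"
  then show "continuous_on (J \<times> UNIV)
      (\<lambda>p. partial_within (J \<times> UNIV) b h p - partial_within (J \<times> UNIV) b k p)"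
    using h k by (intro continuous_on_diff) (auto simp: C1_on_def)
qed

text \<open>
The seminorms are applied to the difference of two fluxes. That the partial derivatives are
additive has to be checked, since they are total functions with unspecified values where the
derivative does not exist.
\<close>

lemma flux_space_diff:
  fixes h k :: "real \<times> (real^'n) \<times> real \<Rightarrow> 'b::real_normed_vector"
  assumes I: "time_interval I" and h: "h \<in> flux_space I" and k: "k \<in> flux_space I"
  shows "(\<lambda>p. h p - k p) \<in> flux_space I"
    and "\<And>t x u. t \<in> closure I \<Longrightarrow> pd_u (\<lambda>p. h p - k p) (t, x, u) = pd_u h (t, x, u) - pd_u k (t, x, u)"
    and "\<And>t x u. t \<in> closure I \<Longrightarrow> grad_x (\<lambda>p. h p - k p) (t, x, u) = grad_x h (t, x, u) - grad_x k (t, x, u)"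
    and "\<And>t x u. t \<in> closure I \<Longrightarrow>
      grad_x (pd_u (\<lambda>p. h p - k p)) (t, x, u) = grad_x (pd_u h) (t, x, u) - grad_x (pd_u k) (t, x, u)"
proof -
  let ?d = "\<lambda>p. h p - k p" and ?J = "closure I"
  have C1: "C1_on (?J \<times> UNIV) h" "C1_on (?J \<times> UNIV) k"
    using h k by (auto simp: flux_space_iff)
  show pu: "pd_u ?d (t, x, u) = pd_u h (t, x, u) - pd_u k (t, x, u)" if "t \<in> ?J" for t x u
    using vector_derivative_at[OF has_vector_derivative_diff[OF
        C1_on_sections(2)[OF I C1(1) that, of x u] C1_on_sections(2)[OF I C1(2) that, of x u]]]
    by (simp add: pd_u_def)
  show "grad_x ?d (t, x, u) = grad_x h (t, x, u) - grad_x k (t, x, u)" if "t \<in> ?J" for t x u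
    using has_derivative_diff[OF C1_on_sections(3)[OF I C1(1) that, of u x]
        C1_on_sections(3)[OF I C1(2) that, of u x]]
    by (intro grad_x_eqI) (simp add: sum_subtractf scaleR_diff_right)
  have put: "((\<lambda>s. pd_u ?d (s, x, u)) has_vector_derivative
      pd_t I (pd_u h) (t, x, u) - pd_t I (pd_u k) (t, x, u)) (at t within ?J)" if "t \<in> ?J" for t x u
    by (rule has_vector_derivative_transform[OF that _ has_vector_derivative_diff[OF
            flux_space_pd_u_sections(1)[OF h that] flux_space_pd_u_sections(1)[OF k that]]])
      (rule pu)
  have pux: "((\<lambda>y. pd_u ?d (t, y, u)) has_derivative
      (\<lambda>l. \<Sum>i\<in>UNIV. l $ i *\<^sub>R (grad_x (pd_u h) (t, x, u) - grad_x (pd_u k) (t, x, u)) $ i)) (at x)"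
    if "t \<in> ?J" for t x u
    using has_derivative_diff[OF flux_space_pd_u_sections(2)[OF h that, of u x]
        flux_space_pd_u_sections(2)[OF k that, of u x]]
    unfolding pu[OF that] by (simp add: sum_subtractf scaleR_diff_right)
  show gpu: "grad_x (pd_u ?d) (t, x, u) = grad_x (pd_u h) (t, x, u) - grad_x (pd_u k) (t, x, u)"
    if "t \<in> ?J" for t x u
    by (rule grad_x_eqI[OF pux[OF that]])
  note hc = flux_space_continuous[OF I h] and kc = flux_space_continuous[OF I k]
  show "?d \<in> flux_space I"
    unfolding flux_space_iff
  proof (intro conjI ballI allI C1_on_diff[OF time_interval_facts(7)[OF I] C1])
    show "continuous_on (?J \<times> UNIV) (pd_t I (pd_u ?d))"
      by (rule continuous_on_eq[OF continuous_on_diff[OF hc(5) kc(5)]]) (auto simp: pd_t_eqI[OF I _ put])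
    show "continuous_on (?J \<times> UNIV) (grad_x (pd_u ?d))"
      by (rule continuous_on_eq[OF continuous_on_diff[OF hc(6) kc(6)]]) (auto simp: gpu)
  qed (auto intro: differentiableI_vector[OF put] differentiableI[OF pux])
qed

text \<open>
Each summand of the seminorm is a nonnegative supremum, since all six functions are continuous
and hence bounded on the compact set \<open>L\<close>.
\<close>

lemma flux_seminorm_bounds:
  fixes \<zeta> :: "real \<times> (real^'n) \<times> real \<Rightarrow> 'b::real_normed_vector"
  assumes I: "time_interval I" and \<zeta>: "\<zeta> \<in> flux_space I"
    and L: "compact L" "L \<subseteq> closure I \<times> UNIV" and p: "p \<in> L"
  shows "norm (pd_u \<zeta> p) \<le> flux_seminorm I L \<zeta>" "norm (grad_x \<zeta> p) \<le> flux_seminorm I L \<zeta>"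
    "norm (grad_x (pd_u \<zeta>) p) \<le> flux_seminorm I L \<zeta>"
proof -
  note c = flux_space_continuous[OF I \<zeta>, THEN continuous_on_subset, OF L(2)]
  note nn = c[THEN sup_norm_on_nonneg[OF L(1)]]
  note le = norm_le_sup_norm_on[OF L(1) _ p]
  show "norm (pd_u \<zeta> p) \<le> flux_seminorm I L \<zeta>"
    using nn le[OF c(3)] by (simp add: flux_seminorm_def)
  show "norm (grad_x \<zeta> p) \<le> flux_seminorm I L \<zeta>"
    using nn le[OF c(4)] by (simp add: flux_seminorm_def)
  show "norm (grad_x (pd_u \<zeta>) p) \<le> flux_seminorm I L \<zeta>"
    using nn le[OF c(6)] by (simp add: flux_seminorm_def)
qed

lemma flux_seminorm_uniform_limits:
  fixes f :: "real \<times> (real^'n) \<times> real \<Rightarrow> 'b::real_normed_vector"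
  assumes I: "time_interval I" and f: "f \<in> flux_space I" "\<And>n. fs n \<in> flux_space I"
    and L: "compact L" "L \<subseteq> closure I \<times> UNIV"
    and conv: "(\<lambda>n. flux_seminorm I L (\<lambda>p. fs n p - f p)) \<longlonglongrightarrow> 0"
  shows "uniform_limit L (\<lambda>n. pd_u (fs n)) (pd_u f) sequentially"
    "uniform_limit L (\<lambda>n. grad_x (fs n)) (grad_x f) sequentially"
    "uniform_limit L (\<lambda>n. grad_x (pd_u (fs n))) (grad_x (pd_u f)) sequentially"
proof -
  have lim: "uniform_limit L as a sequentially"
    if "\<And>n p. p \<in> L \<Longrightarrow> norm (as n p - a p) \<le> flux_seminorm I L (\<lambda>p. fs n p - f p)"
    for as :: "nat \<Rightarrow> real \<times> (real^'n) \<times> real \<Rightarrow> 'c::real_normed_vector" and a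
  proof (rule uniform_limitI)
    fix e :: real assume "e > 0"
    from order_tendstoD(2)[OF conv this]
    show "\<forall>\<^sub>F n in sequentially. \<forall>p\<in>L. dist (as n p) (a p) < e"
    proof eventually_elim
      case (elim n)
      show ?case
      proof
        fix p assume "p \<in> L"
        from le_less_trans[OF that[OF this] elim] show "dist (as n p) (a p) < e"
          by (simp add: dist_norm)
      qed
    qed
  qed
  note d = flux_space_diff[OF I f(2) f(1)]
  note b = flux_seminorm_bounds[OF I d(1) L]
  have diffs: "norm (pd_u (fs n) p - pd_u f p) \<le> flux_seminorm I L (\<lambda>p. fs n p - f p)"
      "norm (grad_x (fs n) p - grad_x f p) \<le> flux_seminorm I L (\<lambda>p. fs n p - f p)"
      "norm (grad_x (pd_u (fs n)) p - grad_x (pd_u f) p) \<le> flux_seminorm I L (\<lambda>p. fs n p - f p)"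
    if p: "p \<in> L" for n p
  proof -
    obtain t x u where ptx: "p = (t, x, u)" "t \<in> closure I"
      using p L(2) by (cases p rule: prod_cases3) auto
    note eqs = d(2,3,4)[OF ptx(2), of n x u, folded ptx(1)]
    show "norm (pd_u (fs n) p - pd_u f p) \<le> flux_seminorm I L (\<lambda>p. fs n p - f p)"
      using b(1)[OF p, of n] by (simp only: eqs)
    show "norm (grad_x (fs n) p - grad_x f p) \<le> flux_seminorm I L (\<lambda>p. fs n p - f p)"
      using b(2)[OF p, of n] by (simp only: eqs)
    show "norm (grad_x (pd_u (fs n)) p - grad_x (pd_u f) p) \<le> flux_seminorm I L (\<lambda>p. fs n p - f p)"
      using b(3)[OF p, of n] by (simp only: eqs)
  qed
  show "uniform_limit L (\<lambda>n. pd_u (fs n)) (pd_u f) sequentially"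
    by (rule lim[OF diffs(1)])
  show "uniform_limit L (\<lambda>n. grad_x (fs n)) (grad_x f) sequentially"
    by (rule lim[OF diffs(2)])
  show "uniform_limit L (\<lambda>n. grad_x (pd_u (fs n))) (grad_x (pd_u f)) sequentially"
    by (rule lim[OF diffs(3)])
qed

lemma uniform_limit_div_x:
  assumes "uniform_limit L (\<lambda>n. grad_x (Fs n)) (grad_x F) sequentially"
  shows "uniform_limit L (\<lambda>n. div_x (Fs n)) (div_x F) sequentially"
proof -
  have "bounded_linear (\<lambda>A :: (real^'n)^'n. \<Sum>i\<in>UNIV. A $ i $ i)"
    by (intro bounded_linear_sum bounded_linear_compose[OF bounded_linear_vec_nth bounded_linear_vec_nth])
  from bounded_linear.uniform_limit[OF this assms] show ?thesis
    by (simp add: div_x_def[abs_def])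
qed

lemma uniform_limit_Pair:
  assumes "uniform_limit X f l F" "uniform_limit X g m F"
  shows "uniform_limit X (\<lambda>n x. (f n x, g n x)) (\<lambda>x. (l x, m x)) F"
proof (rule uniform_limitI)
  fix e :: real assume "e > 0"
  then have "e / 2 > 0" by simp
  from uniform_limitD[OF assms(1) this] uniform_limitD[OF assms(2) this]
  show "\<forall>\<^sub>F n in F. \<forall>x\<in>X. dist (f n x, g n x) (l x, m x) < e"
  proof eventually_elim
    case (elim n)
    show ?case
    proof
      fix x assume "x \<in> X"
      then have "dist (f n x) (l x) < e / 2" "dist (g n x) (m x) < e / 2"
        using elim by auto
      then show "dist (f n x, g n x) (l x, m x) < e"
        using sqrt_sum_squares_le_sum_abs[of "dist (f n x) (l x)" "dist (g n x) (m x)"]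
        by (simp add: dist_Pair_Pair)
    qed
  qed
qed

lemma uniform_limit_deriv_weighted:
  fixes h :: "real \<times> (real^'n) \<times> real \<Rightarrow> 'b::real_normed_vector"
  assumes E: "uniform_limit {-C..C} (\<lambda>n. deriv (Es n)) (deriv E) sequentially"
    "E C1_differentiable_on UNIV"
    and h: "uniform_limit (cylinder K C) hs h sequentially" "continuous_on (cylinder K C) h"
    and K: "compact K"
  shows "uniform_limit (cylinder K C) (\<lambda>n. deriv_weighted (Es n) (hs n)) (deriv_weighted E h) sequentially"
proof -
  note cyl = compact_cylinder[OF K, of C]
  have "uniform_limit (cylinder K C) (\<lambda>n p. deriv (Es n) (snd (snd p))) (\<lambda>p. deriv E (snd (snd p))) sequentially"
    by (rule uniform_limit_compose'[OF E(1)]) (auto simp: cylinder_def)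
  moreover have "continuous_on (cylinder K C) (\<lambda>p. deriv E (snd (snd p)))"
    by (rule continuous_on_compose2[OF C1_differentiable_onD(1)[OF E(2)]]) (auto intro!: continuous_intros)
  ultimately have "uniform_limit (cylinder K C) (\<lambda>n p. deriv (Es n) (snd (snd p)) *\<^sub>R hs n p)
      (\<lambda>p. deriv E (snd (snd p)) *\<^sub>R h p) sequentially"
    using h cyl
    by (intro bounded_bilinear.bounded_uniform_limit[OF bounded_bilinear_scaleR] h
        compact_imp_bounded compact_continuous_image)
  then show ?thesis by (simp add: deriv_weighted_def[abs_def])
qed

section \<open>Test functions\<close>

lemma partial_within_cong:
  assumes "p \<in> S" "\<And>q. q \<in> S \<Longrightarrow> h q = k q"
  shows "partial_within S b h p = partial_within S b k p"
proof -
  have "(h has_derivative D) (at p within S) \<longleftrightarrow> (k has_derivative D) (at p within S)" for D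
    using assms has_derivative_transform[of p S k h D] has_derivative_transform[of p S h k D]
    by auto
  then show ?thesis by (simp add: partial_within_def frechet_derivative_def)
qed

lemma iter_partial_cong:
  assumes "\<And>q. q \<in> S \<Longrightarrow> h q = k q" "p \<in> S"
  shows "iter_partial S bs h p = iter_partial S bs k p"
  using assms
proof (induction bs arbitrary: h k)
  case (Cons b bs)
  have "partial_within S b h q = partial_within S b k q" if "q \<in> S" for q
    using that Cons.prems(1) by (rule partial_within_cong)
  from Cons.IH[OF this Cons.prems(2)] show ?case by simp
qed simp

lemma differentiable_on_cong:
  assumes "h differentiable_on S" "\<And>q. q \<in> S \<Longrightarrow> k q = h q"
  shows "k differentiable_on S"
  unfolding differentiable_on_def
proof
  fix p assume p: "p \<in> S"
  then obtain D where "(h has_derivative D) (at p within S)"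
    using assms(1) by (auto simp: differentiable_on_def differentiable_def)
  from has_derivative_transform[OF p assms(2) this]
  show "k differentiable at p within S" by (rule differentiableI)
qed

lemma partial_within_lincomb:
  fixes h k :: "real \<times> 'c::euclidean_space \<Rightarrow> real"
  assumes J: "\<And>t. t \<in> J \<Longrightarrow> t islimpt J"
    and diff: "h differentiable_on J \<times> UNIV" "k differentiable_on J \<times> UNIV" 
    and pJ: "p \<in> J \<times> UNIV"
  shows "partial_within (J \<times> UNIV) b (\<lambda>p. c * h p + d * k p) p
      = c * partial_within (J \<times> UNIV) b h p + d * partial_within (J \<times> UNIV) b k p"
proof -
  obtain t z where p: "p = (t, z)" "t \<in> J" using pJ by auto
  let ?D = "\<lambda>h. frechet_derivative h (at (t, z) within J \<times> UNIV)"
  have "(h has_derivative ?D h) (at (t, z) within J \<times> UNIV)"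
      "(k has_derivative ?D k) (at (t, z) within J \<times> UNIV)"
    using diff p by (auto simp: differentiable_on_def simp flip: frechet_derivative_works)
  then have "((\<lambda>p. c * h p + d * k p) has_derivative (\<lambda>b. c * ?D h b + d * ?D k b))
      (at (t, z) within J \<times> UNIV)"
    by (intro has_derivative_add has_derivative_mult_right)
  from frechet_derivative_Times_UNIV[OF p(2) J[OF p(2)] this]
  show ?thesis unfolding partial_within_def p(1) by (rule fun_cong)
qed

lemma smooth_within_partial:
  assumes "smooth_within S h" "b \<in> Basis"
  shows "smooth_within S (partial_within S b h)"
  unfolding smooth_within_def
proof
  fix bs :: "'a list" assume "bs \<in> lists Basis"
  then have "b # bs \<in> lists Basis" using assms(2) by simp
  with assms(1) have "iter_partial S (b # bs) h differentiable_on S"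
    unfolding smooth_within_def by blast
  then show "iter_partial S bs (partial_within S b h) differentiable_on S" by simp
qed

lemma smooth_within_differentiable: "smooth_within S h \<Longrightarrow> h differentiable_on S"
  unfolding smooth_within_def by (drule bspec[of _ _ "[]"]) auto

text \<open>
Each partial derivative is linear only at points of the slab; off the slab its values are
unspecified, and \<open>iter_partial_cong\<close> says that they do not propagate to iterated derivatives.
\<close>

lemma iter_partial_lincomb:
  fixes h k :: "real \<times> 'c::euclidean_space \<Rightarrow> real"
  assumes J: "\<And>t. t \<in> J \<Longrightarrow> t islimpt J"
    and "smooth_within (J \<times> UNIV) h" "smooth_within (J \<times> UNIV) k" "bs \<in> lists Basis" "p \<in> J \<times> UNIV"
  shows "iter_partial (J \<times> UNIV) bs (\<lambda>p. c * h p + d * k p) p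
      = c * iter_partial (J \<times> UNIV) bs h p + d * iter_partial (J \<times> UNIV) bs k p"
  using assms(2-5)
proof (induction bs arbitrary: h k)
  case (Cons b bs)
  let ?P = "partial_within (J \<times> UNIV) b"
  have b: "b \<in> Basis" "bs \<in> lists Basis" using Cons.prems(3) by auto
  have "iter_partial (J \<times> UNIV) bs (?P (\<lambda>p. c * h p + d * k p)) p
      = iter_partial (J \<times> UNIV) bs (\<lambda>p. c * ?P h p + d * ?P k p) p"
    by (rule iter_partial_cong[OF _ Cons.prems(4)])
      (rule partial_within_lincomb[OF J Cons.prems(1,2)[THEN smooth_within_differentiable]])
  also have "\<dots> = c * iter_partial (J \<times> UNIV) bs (?P h) p + d * iter_partial (J \<times> UNIV) bs (?P k) p"
    by (rule Cons.IH[OF Cons.prems(1,2)[THEN smooth_within_partial[OF _ b(1)]] b(2) Cons.prems(4)])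
  finally show ?case by simp
qed simp

lemma smooth_within_lincomb:
  fixes h k :: "real \<times> 'c::euclidean_space \<Rightarrow> real"
  assumes J: "\<And>t. t \<in> J \<Longrightarrow> t islimpt J"
    and "smooth_within (J \<times> UNIV) h" "smooth_within (J \<times> UNIV) k"
  shows "smooth_within (J \<times> UNIV) (\<lambda>p. c * h p + d * k p)"
  unfolding smooth_within_def
proof
  fix bs :: "(real \<times> 'c) list" assume bs: "bs \<in> lists Basis"
  let ?i = "iter_partial (J \<times> UNIV) bs"
  have "?i h differentiable_on J \<times> UNIV" "?i k differentiable_on J \<times> UNIV"
    using assms bs by (auto simp: smooth_within_def)
  then have "(\<lambda>p. c * ?i h p + d * ?i k p) differentiable_on J \<times> UNIV"
    by (intro derivative_intros)
  then show "?i (\<lambda>p. c * h p + d * k p) differentiable_on J \<times> UNIV"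
    by (rule differentiable_on_cong) (rule iter_partial_lincomb[OF assms bs])
qed

text \<open>
The components are ordered to match those of the density of the entropy production.
\<close>

definition test_jet ::
  "real set \<Rightarrow> (real \<times> (real^'n) \<Rightarrow> real) \<Rightarrow> real \<times> (real^'n) \<Rightarrow> real \<times> (real^'n) \<times> real" where
  "test_jet I \<phi> p = (test_dt I \<phi> p, test_grad \<phi> p, \<phi> p)"

lemma test_function_partials:
  fixes \<phi> :: "real \<times> (real^'n) \<Rightarrow> real"
  assumes I: "time_interval I" and \<phi>: "\<phi> \<in> test_functions I" and t: "t \<in> I"
  shows "test_dt I \<phi> (t, x) = partial_within (I \<times> UNIV) (1, 0) \<phi> (t, x)"
    and "test_grad \<phi> (t, x) $ i = partial_within (I \<times> UNIV) (0, axis i 1) \<phi> (t, x)"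
    and "((\<lambda>y. \<phi> (t, y)) has_derivative (\<lambda>k. test_grad \<phi> (t, x) \<bullet> k)) (at x)"
proof -
  define D where "D = frechet_derivative \<phi> (at (t, x) within I \<times> UNIV)"
  have "\<phi> differentiable_on I \<times> UNIV"
    using \<phi> by (auto simp: test_functions_def smooth_within_differentiable)
  then have D: "(\<phi> has_derivative D) (at (t, x) within I \<times> UNIV)"
    unfolding D_def using t by (auto simp: differentiable_on_def simp flip: frechet_derivative_works)
  have pw: "partial_within (I \<times> UNIV) b \<phi> (t, x) = D b" for b
    by (simp add: partial_within_def D_def)
  show "test_dt I \<phi> (t, x) = partial_within (I \<times> UNIV) (1, 0) \<phi> (t, x)"
    using vector_derivative_within[OF _ has_vector_derivative_time_section[OF D]]
      time_interval_facts(6)[OF I t]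
    by (simp add: test_dt_def pw trivial_limit_within)
  note dx = has_derivative_space_section[OF D t]
  have g: "test_grad \<phi> (t, x) $ i = D (0, axis i 1)" for i
    using frechet_derivative_at[OF dx, symmetric] by (simp add: test_grad_def)
  then show "test_grad \<phi> (t, x) $ i = partial_within (I \<times> UNIV) (0, axis i 1) \<phi> (t, x)"
    by (simp add: pw)
  have "D (0, k) = test_grad \<phi> (t, x) \<bullet> k" for k
    using linear_vec_expansion[OF has_derivative_linear[OF dx], of k]
    by (simp add: inner_vec_def g mult.commute)
  with dx show "((\<lambda>y. \<phi> (t, y)) has_derivative (\<lambda>k. test_grad \<phi> (t, x) \<bullet> k)) (at x)"
    by simp
qed

lemma test_function_continuous:
  fixes \<phi> :: "real \<times> (real^'n) \<Rightarrow> real"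
  assumes I: "time_interval I" and \<phi>: "\<phi> \<in> test_functions I"
  shows "continuous_on (I \<times> UNIV) \<phi>" "continuous_on (I \<times> UNIV) (test_dt I \<phi>)"
    "continuous_on (I \<times> UNIV) (test_grad \<phi>)" "continuous_on (I \<times> UNIV) (test_jet I \<phi>)"
proof -
  have sm: "smooth_within (I \<times> UNIV) \<phi>" using \<phi> by (simp add: test_functions_def)
  show 1: "continuous_on (I \<times> UNIV) \<phi>"
    using smooth_within_differentiable[OF sm] by (rule differentiable_imp_continuous_on)
  have pw: "continuous_on (I \<times> UNIV) (partial_within (I \<times> UNIV) b \<phi>)" if "b \<in> Basis" for b
    using smooth_within_differentiable[OF smooth_within_partial[OF sm that]]
    by (rule differentiable_imp_continuous_on)
  show 2: "continuous_on (I \<times> UNIV) (test_dt I \<phi>)"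
    by (rule continuous_on_eq[OF pw[of "(1, 0)"]])
      (auto simp: Basis_prod_def test_function_partials(1)[OF I \<phi>])
  have "continuous_on (I \<times> UNIV) (\<lambda>p. test_grad \<phi> p $ i)" for i
    by (rule continuous_on_eq[OF pw[of "(0, axis i 1)"]])
      (auto simp: Basis_prod_def Basis_vec_def test_function_partials(2)[OF I \<phi>])
  then have "continuous_on (I \<times> UNIV) (\<lambda>p. \<chi> i. test_grad \<phi> p $ i)"
    by (rule continuous_on_vec_lambda)
  then show 3: "continuous_on (I \<times> UNIV) (test_grad \<phi>)"
    by (simp add: vec_lambda_eta)
  show "continuous_on (I \<times> UNIV) (test_jet I \<phi>)"
    unfolding test_jet_def[abs_def] by (intro continuous_on_Pair 1 2 3)
qed

text \<open>
The complement of \<open>K\<close> is open, so outside \<open>K\<close> the test function vanishes near the point as well,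
and its derivatives vanish with it.
\<close>

lemma test_function_zero:
  fixes \<phi> :: "real \<times> (real^'n) \<Rightarrow> real"
  assumes I: "time_interval I" and \<phi>: "\<phi> \<in> test_functions I"
    and K: "compact K" "support_on (I \<times> UNIV) \<phi> \<subseteq> K" and p: "p \<in> I \<times> UNIV - K"
  shows "\<phi> p = 0" "test_dt I \<phi> p = 0" "test_grad \<phi> p = 0" "test_jet I \<phi> p = 0"
proof -
  have z: "\<phi> q = 0" if "q \<in> I \<times> UNIV - K" for q
    using K(2) that by (auto simp: support_on_def)
  show 1: "\<phi> p = 0" using z[OF p] .
  obtain t x where tx: "p = (t, x)" "t \<in> I" using p by auto
  have "open (- K)" using K(1) by (simp add: compact_imp_closed open_Compl)
  then obtain e where e: "e > 0" "ball p e \<subseteq> - K"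
    using p by (auto simp: open_contains_ball)
  have "(\<phi> has_derivative (\<lambda>_. 0)) (at p within I \<times> UNIV)"
    by (rule has_derivative_transform_within[OF has_derivative_const[of 0] e(1)])
      (use p e(2) z in \<open>auto simp: subset_iff dist_commute\<close>)
  then have pw: "partial_within (I \<times> UNIV) b \<phi> (t, x) = 0" for b
    using frechet_derivative_Times_UNIV[OF tx(2) time_interval_facts(6)[OF I tx(2)], of \<phi> _ x]
    by (simp add: partial_within_def tx(1))
  show 2: "test_dt I \<phi> p = 0"
    using test_function_partials(1)[OF I \<phi> tx(2)] pw by (simp add: tx(1))
  show 3: "test_grad \<phi> p = 0"
    using test_function_partials(2)[OF I \<phi> tx(2)] pw by (simp add: tx(1) vec_eq_iff)
  show "test_jet I \<phi> p = 0" using 1 2 3 by (simp add: test_jet_def zero_prod_def)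
qed

lemma test_function_support:
  assumes "\<phi> \<in> test_functions I"
  obtains K where "compact K" "K \<subseteq> I \<times> UNIV" "support_on (I \<times> UNIV) \<phi> \<subseteq> K"
  using assms closure_subset[of "support_on (I \<times> UNIV) \<phi>"] unfolding test_functions_def by blast

lemma test_functions_lincomb:
  fixes \<phi> \<psi> :: "real \<times> (real^'n) \<Rightarrow> real"
  assumes I: "time_interval I" and \<phi>: "\<phi> \<in> test_functions I" and \<psi>: "\<psi> \<in> test_functions I"
  shows "(\<lambda>p. c * \<phi> p + d * \<psi> p) \<in> test_functions I"
    and "\<And>p. p \<in> I \<times> UNIV \<Longrightarrow>
      test_jet I (\<lambda>p. c * \<phi> p + d * \<psi> p) p = c *\<^sub>R test_jet I \<phi> p + d *\<^sub>R test_jet I \<psi> p"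
proof -
  let ?l = "\<lambda>p. c * \<phi> p + d * \<psi> p" and ?s = "support_on (I \<times> UNIV)"
  note sm = \<phi>[unfolded test_functions_def, simplified, THEN conjunct1]
    \<psi>[unfolded test_functions_def, simplified, THEN conjunct1]
  have sub: "closure (?s ?l) \<subseteq> closure (?s \<phi>) \<union> closure (?s \<psi>)"
    unfolding closure_Un[symmetric] by (intro closure_mono) (auto simp: support_on_def)
  moreover have "compact (closure (?s \<phi>) \<union> closure (?s \<psi>))"
    using \<phi> \<psi> by (auto simp: test_functions_def)
  ultimately have "compact (closure (?s ?l))"
    by (meson bounded_subset closed_closure compact_eq_bounded_closed)
  with sub show l: "?l \<in> test_functions I"
    using \<phi> \<psi> smooth_within_lincomb[OF time_interval_facts(6)[OF I] sm]
    by (auto simp: test_functions_def)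
  fix p :: "real \<times> (real^'n)" assume p: "p \<in> I \<times> UNIV"
  then obtain t x where tx: "p = (t, x)" "t \<in> I" by auto
  note pl = partial_within_lincomb[OF time_interval_facts(6)[OF I] sm[THEN smooth_within_differentiable] p,
      where c = c and d = d, unfolded tx(1)]
  show "test_jet I ?l p = c *\<^sub>R test_jet I \<phi> p + d *\<^sub>R test_jet I \<psi> p"
    using test_function_partials(1,2)[OF I l tx(2), of x]
      test_function_partials(1,2)[OF I \<phi> tx(2), of x] test_function_partials(1,2)[OF I \<psi> tx(2), of x]
    by (simp add: test_jet_def tx(1) vec_eq_iff pl)
qed

lemma norm_test_jet_le:
  fixes \<phi> :: "real \<times> (real^'n) \<Rightarrow> real"
  assumes I: "time_interval I" and \<phi>: "\<phi> \<in> test_functions I"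
    and K: "compact K" "K \<subseteq> I \<times> UNIV"
  shows "0 \<le> Cm_norm_on I K 1 \<phi>"
    and "\<And>p. p \<in> K \<Longrightarrow> \<bar>\<phi> p\<bar> \<le> Cm_norm_on I K 1 \<phi>"
    and "\<And>p. p \<in> K \<Longrightarrow> norm (test_jet I \<phi> p) \<le> (2 + CARD('n)) * Cm_norm_on I K 1 \<phi>"
proof -
  let ?A = "{bs :: (real \<times> (real^'n)) list. set bs \<subseteq> Basis \<and> length bs \<le> 1}"
  let ?i = "\<lambda>bs. iter_partial (I \<times> UNIV) bs \<phi>"
  have fin: "finite ?A" by (rule finite_lists_length_le) simp
  have cont: "continuous_on K (?i bs)" if "bs \<in> ?A" for bs
    using \<phi> that K(2) unfolding test_functions_def smooth_within_def
    by (auto intro!: continuous_on_subset[OF differentiable_imp_continuous_on])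
  have nn: "0 \<le> sup_norm_on K (?i bs)" if "bs \<in> ?A" for bs
    by (rule sup_norm_on_nonneg[OF K(1) cont[OF that]])
  show C: "0 \<le> Cm_norm_on I K 1 \<phi>"
    unfolding Cm_norm_on_def by (rule sum_nonneg) (rule nn)
  have le: "\<bar>?i bs p\<bar> \<le> Cm_norm_on I K 1 \<phi>" if "bs \<in> ?A" "p \<in> K" for bs p
  proof -
    have "norm (?i bs p) \<le> sup_norm_on K (?i bs)"
      by (rule norm_le_sup_norm_on[OF K(1) cont[OF that(1)] that(2)])
    also have "\<dots> \<le> Cm_norm_on I K 1 \<phi>"
      unfolding Cm_norm_on_def using nn fin that(1) by (intro member_le_sum) auto
    finally show ?thesis by simp
  qed
  show 1: "\<bar>\<phi> p\<bar> \<le> Cm_norm_on I K 1 \<phi>" if "p \<in> K" for p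
    using le[of "[]" p] that by simp
  show "norm (test_jet I \<phi> p) \<le> (2 + CARD('n)) * Cm_norm_on I K 1 \<phi>" if p: "p \<in> K" for p
  proof -
    obtain t x where tx: "p = (t, x)" "t \<in> I" using p K(2) by (cases p) auto
    have 2: "\<bar>test_dt I \<phi> p\<bar> \<le> Cm_norm_on I K 1 \<phi>"
      using le[of "[(1, 0)]" p] p test_function_partials(1)[OF I \<phi> tx(2), of x]
      by (simp add: tx(1) Basis_prod_def)
    have "(0, axis i 1) \<in> (Basis :: (real \<times> (real^'n)) set)" for i
      by (auto simp: Basis_prod_def Basis_vec_def)
    then have 3: "\<bar>test_grad \<phi> p $ i\<bar> \<le> Cm_norm_on I K 1 \<phi>" for i
      using le[of "[(0, axis i 1)]" p] p test_function_partials(2)[OF I \<phi> tx(2), of x i]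
      by (simp add: tx(1))
    have "norm (test_grad \<phi> p) \<le> (\<Sum>i\<in>UNIV. \<bar>test_grad \<phi> p $ i\<bar>)" by (rule norm_le_l1_cart)
    also have "\<dots> \<le> CARD('n) * Cm_norm_on I K 1 \<phi>"
      using sum_bounded_above[of UNIV "\<lambda>i. \<bar>test_grad \<phi> p $ i\<bar>", OF 3] by simp
    finally have 4: "norm (test_grad \<phi> p) \<le> CARD('n) * Cm_norm_on I K 1 \<phi>" .
    have "norm (test_jet I \<phi> p) \<le> norm (test_dt I \<phi> p) + (norm (test_grad \<phi> p) + norm (\<phi> p))"
      unfolding test_jet_def by (intro order_trans[OF norm_Pair_le] add_left_mono norm_Pair_le)
    with 1[OF p] 2 4 show ?thesis by (simp add: algebra_simps)
  qed
qed

section \<open>Entropy production as the integral of a density\<close>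

lemma has_vector_derivative_along_line:
  assumes "(h has_derivative h') (at x)"
  shows "((\<lambda>s. h (x + s *\<^sub>R v)) has_vector_derivative h' v) (at 0)"
proof -
  have "((\<lambda>s. x + s *\<^sub>R v) has_derivative (\<lambda>s. s *\<^sub>R v)) (at 0)"
    by (auto intro!: derivative_eq_intros)
  from has_derivative_compose[OF this, of h h'] assms
  have d: "((\<lambda>s. h (x + s *\<^sub>R v)) has_derivative (\<lambda>s. h' (s *\<^sub>R v))) (at 0)" by simp
  show ?thesis
    using d unfolding has_vector_derivative_def linear_scale[OF has_derivative_linear[OF assms]] .
qed

lemma time_space_borel: "time_interval I \<Longrightarrow> I \<times> (UNIV :: (real^'n) set) \<in> sets borel"
  using time_interval_facts(2) by (intro borel_Times) auto

lemma continuous_on_at_u_0: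
  assumes "time_interval I" "continuous_on (closure I \<times> UNIV) h"
  shows "continuous_on (I \<times> UNIV) (\<lambda>p. h (fst p, snd p, 0 :: real))"
  by (rule continuous_on_compose2[OF assms(2)])
    (use time_interval_facts(5)[OF assms(1)] in \<open>auto intro!: continuous_intros\<close>)

lemma continuous_on_reassoc:
  assumes "time_interval I" "continuous_on (closure I \<times> UNIV) h"
  shows "continuous_on ((I \<times> UNIV) \<times> UNIV) (\<lambda>(p, w). h (fst p, snd p, w :: real))"
  unfolding split_beta
  by (rule continuous_on_compose2[OF assms(2)])
    (use time_interval_facts(5)[OF assms(1)] in \<open>auto intro!: continuous_intros\<close>)

text \<open>
The function \<open>k\<close> is the divergence of \<open>\<phi>(t,x) F(t,x,0)\<close> in \<open>x\<close>, a sum of \<open>n\<close> directional derivatives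
of functions with compact support. It is the contribution to the entropy production of the part
of a flux that does not depend on \<open>u\<close>.
\<close>

lemma integral_div_test_function_eq_0:
  fixes F :: "real \<times> (real^'n) \<times> real \<Rightarrow> real^'n"
  assumes I: "time_interval I" and F: "C1_on (closure I \<times> UNIV) F" and \<phi>: "\<phi> \<in> test_functions I"
  defines "k \<equiv> \<lambda>p. F (fst p, snd p, 0) \<bullet> test_grad \<phi> p + div_x F (fst p, snd p, 0) * \<phi> p"
  shows "integrable (lebesgue_on (I \<times> UNIV)) k" "(LINT p|lebesgue_on (I \<times> UNIV). k p) = 0"
proof -
  let ?S = "I \<times> (UNIV :: (real^'n) set)" and ?q = "\<lambda>p. (fst p, snd p, 0) :: real \<times> (real^'n) \<times> real"
  obtain K where K: "compact K" "K \<subseteq> ?S" "support_on ?S \<phi> \<subseteq> K"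
    using \<phi> by (rule test_function_support)
  note z = test_function_zero[OF I \<phi> K(1,3)]
  note S = time_space_borel[OF I, where 'n = 'n]
  note c\<phi> = test_function_continuous[OF I \<phi>]
  note cF = C1_on_continuous(1,4)[OF I F, THEN continuous_on_at_u_0[OF I]]
  define k' where "k' = (\<lambda>i p. F (?q p) $ i * test_grad \<phi> p $ i + grad_x F (?q p) $ i $ i * \<phi> p)"
  have ck': "continuous_on ?S (k' i)" for i
    unfolding k'_def by (intro continuous_intros cF c\<phi>)
  have zk': "k' i p = 0" if "p \<in> ?S - K" for i p
    using z[OF that] by (simp add: k'_def)
  have int: "integrable (lebesgue_on ?S) (k' i)" for i
  proof -
    have "(\<lambda>_. 0) \<in> Linf_on ?S" by (auto simp: Linf_on_def)
    from integrable_pairing_Linf[OF S K(1,2) _ this ck' zk', of "\<lambda>_. 1" i]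
    show ?thesis by simp
  qed
  have zero: "(LINT p|lebesgue_on ?S. k' i p) = 0" for i
  proof (rule integral_directional_derivative_eq_0[where e = "(0, axis i 1)" and k = "\<lambda>p. F (?q p) $ i * \<phi> p", OF S _ K(1,2) _ _ ck' zk'])
    show "continuous_on ?S (\<lambda>p. F (?q p) $ i * \<phi> p)"
      by (intro continuous_intros cF c\<phi>)
    show "F (?q p) $ i * \<phi> p = 0" if "p \<in> ?S - K" for p
      using z[OF that] by simp
    show "p + s *\<^sub>R (0, axis i 1) \<in> ?S" if "p \<in> ?S" for p s
      using that by (cases p) auto
    fix p :: "real \<times> (real^'n)" assume p: "p \<in> ?S"
    then obtain t x where tx: "p = (t, x)" "t \<in> I" by auto
    then have t: "t \<in> closure I" using time_interval_facts(5)[OF I] by auto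
    have "((\<lambda>s. F (t, x + s *\<^sub>R axis i 1, 0) $ i) has_real_derivative grad_x F (t, x, 0) $ i $ i) (at 0)"
    proof -
      have "(\<Sum>j\<in>UNIV. axis i 1 $ j *\<^sub>R grad_x F (t, x, 0) $ j) = grad_x F (t, x, 0) $ i"
      proof -
        have "(\<Sum>j\<in>UNIV. axis i 1 $ j *\<^sub>R grad_x F (t, x, 0) $ j)
            = (\<Sum>j\<in>UNIV. if j = i then grad_x F (t, x, 0) $ i else 0)"
          by (intro sum.cong) (auto simp: axis_def)
        then show ?thesis by simp
      qed
      with has_vector_derivative_along_line[OF C1_on_sections(3)[OF I F t, of 0 x], of "axis i 1"]
      have "((\<lambda>s. F (t, x + s *\<^sub>R axis i 1, 0)) has_vector_derivative grad_x F (t, x, 0) $ i) (at 0)"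
        by simp
      from bounded_linear.has_vector_derivative[OF bounded_linear_vec_nth this]
      show ?thesis by (simp add: has_real_derivative_iff_has_vector_derivative)
    qed
    moreover have "((\<lambda>s. \<phi> (t, x + s *\<^sub>R axis i 1)) has_real_derivative test_grad \<phi> (t, x) $ i) (at 0)"
      using has_vector_derivative_along_line[OF test_function_partials(3)[OF I \<phi> tx(2), of x], of "axis i 1"]
      by (simp add: has_real_derivative_iff_has_vector_derivative inner_axis)
    ultimately show "((\<lambda>s. F (?q (p + s *\<^sub>R (0, axis i 1))) $ i * \<phi> (p + s *\<^sub>R (0, axis i 1)))
        has_real_derivative k' i p) (at 0)"
      by (auto simp: tx(1) k'_def mult_ac intro!: derivative_eq_intros)
  qed
  have k: "k = (\<lambda>p. \<Sum>i\<in>UNIV. k' i p)"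
    by (simp add: k_def k'_def inner_vec_def div_x_def sum.distrib sum_distrib_right fun_eq_iff)
  show "integrable (lebesgue_on ?S) k" unfolding k using int by simp
  show "(LINT p|lebesgue_on ?S. k p) = 0" unfolding k using int zero by simp
qed

text \<open>
The coefficients of \<open>\<partial>\<^sub>t\<phi>\<close>, \<open>\<nabla>\<phi>\<close> and \<open>\<phi>\<close> in the entropy production, formed with the normalised flux.
\<close>

definition production_density ::
  "(real \<times> (real^'n) \<times> real \<Rightarrow> real^'n) \<Rightarrow> (real \<times> (real^'n) \<times> real \<Rightarrow> real) \<Rightarrow> (real \<Rightarrow> real)
    \<Rightarrow> (real \<times> (real^'n)) \<times> real \<Rightarrow> real \<times> (real^'n) \<times> real" where
  "production_density f g E = (\<lambda>(p, w). (E w, normalised_flux f E (fst p, snd p, w),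
     deriv_weighted E (\<lambda>q. g q - div_x f q) (fst p, snd p, w) + div_x (normalised_flux f E) (fst p, snd p, w)))"

lemma continuous_on_production_density:
  assumes I: "time_interval I" and f: "f \<in> flux_space I"
    and g: "continuous_on (closure I \<times> UNIV) g" and E: "E C1_differentiable_on UNIV"
  shows "continuous_on ((I \<times> UNIV) \<times> UNIV) (production_density f g E)"
proof -
  have G: "normalised_flux f E \<in> flux_space I"
    using entropy_flux_normalised[OF I f E] by (simp add: entropy_flux_def)
  note fc = flux_space_continuous[OF I f] and Gc = flux_space_continuous[OF I G]
  have "continuous_on ((I \<times> UNIV) \<times> UNIV) (\<lambda>q. (E (snd q), normalised_flux f E (fst (fst q), snd (fst q), snd q),
     deriv_weighted E (\<lambda>q. g q - div_x f q) (fst (fst q), snd (fst q), snd q) + div_x (normalised_flux f E) (fst (fst q), snd (fst q), snd q)))"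
    using continuous_on_reassoc[OF I Gc(1)]
      continuous_on_reassoc[OF I continuous_on_deriv_weighted[OF E continuous_on_diff[OF g continuous_on_div_x[OF fc(4)]]]]
      continuous_on_reassoc[OF I continuous_on_div_x[OF Gc(4)]]
    unfolding split_beta
    by (intro continuous_intros continuous_on_compose2[OF C1_differentiable_onD(2)[OF E]]) auto
  then show ?thesis by (simp add: production_density_def split_beta)
qed

text \<open>
The chosen flux is \<open>F = G + D\<close> with \<open>G\<close> normalised and \<open>D\<close> independent of \<open>u\<close>. The four space-time
integrals may be merged because each integrand is integrable; the terms with \<open>D\<close> then form an
exact divergence and drop out.
\<close>

lemma entropy_production_eq:
  fixes f :: "real \<times> (real^'n) \<times> real \<Rightarrow> real^'n"
  assumes I: "time_interval I" and f: "f \<in> flux_space I"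
    and g: "continuous_on (closure I \<times> UNIV) g" and E: "E C1_differentiable_on UNIV"
    and u: "u \<in> Linf_on (I \<times> UNIV)" and \<phi>: "\<phi> \<in> test_functions I"
  shows "entropy_production I f g u\<^sub>o u E \<phi> =
      (LINT p|lebesgue_on (I \<times> UNIV). production_density f g E (p, u p) \<bullet> test_jet I \<phi> p)
      + (LINT x|lebesgue. E (u\<^sub>o x) * \<phi> (0, x))"
proof -
  let ?S = "I \<times> (UNIV :: (real^'n) set)"
  define F where "F = (SOME F. entropy_flux I f E F)"
  have F: "entropy_flux I f E F"
    unfolding F_def by (rule someI[where P = "entropy_flux I f E", OF entropy_flux_normalised[OF I f E]])
  then have Ff: "F \<in> flux_space I" by (simp add: entropy_flux_def)
  note C1 = Ff[unfolded flux_space_iff, THEN conjunct1]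
  obtain K where K: "compact K" "K \<subseteq> ?S" "support_on ?S \<phi> \<subseteq> K"
    using \<phi> by (rule test_function_support)
  note z = test_function_zero[OF I \<phi> K(1,3)]
  note S = time_space_borel[OF I, where 'n = 'n]
  note c\<phi> = test_function_continuous[OF I \<phi>]
  note fc = flux_space_continuous[OF I f] and Fc = flux_space_continuous[OF I Ff]
  have int: "integrable (lebesgue_on ?S) (\<lambda>p. h (fst p, snd p, u p) * \<psi> p)"
    if "continuous_on (closure I \<times> UNIV) h" "continuous_on ?S \<psi>" "\<And>p. p \<in> ?S - K \<Longrightarrow> \<psi> p = 0"
    for h and \<psi> :: "real \<times> (real^'n) \<Rightarrow> real"
    using integrable_pairing_Linf[OF S K(1,2) continuous_on_reassoc[OF I that(1)] u that(2,3)] by simp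
  have i1: "integrable (lebesgue_on ?S) (\<lambda>p. E (u p) * test_dt I \<phi> p + F (fst p, snd p, u p) \<bullet> test_grad \<phi> p)"
  proof (rule Bochner_Integration.integrable_add)
    show "integrable (lebesgue_on ?S) (\<lambda>p. E (u p) * test_dt I \<phi> p)"
    proof -
      have "continuous_on (closure I \<times> UNIV) (\<lambda>q :: real \<times> (real^'n) \<times> real. E (snd (snd q)))"
        by (rule continuous_on_compose2[OF C1_differentiable_onD(2)[OF E]]) (auto intro!: continuous_intros)
      from int[OF this c\<phi>(2) z(2)] show ?thesis by simp
    qed
    show "integrable (lebesgue_on ?S) (\<lambda>p. F (fst p, snd p, u p) \<bullet> test_grad \<phi> p)"
      using integrable_pairing_Linf[OF S K(1,2) continuous_on_reassoc[OF I Fc(1)] u c\<phi>(3) z(3)] by simp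
  qed
  have i2: "integrable (lebesgue_on ?S) (\<lambda>p. deriv E (u p) * div_x f (fst p, snd p, u p) * \<phi> p)"
    using int[OF continuous_on_deriv_weighted[OF E continuous_on_div_x[OF fc(4)]] c\<phi>(1) z(1)]
    by (simp add: deriv_weighted_def)
  have i3: "integrable (lebesgue_on ?S) (\<lambda>p. div_x F (fst p, snd p, u p) * \<phi> p)"
    by (rule int[OF continuous_on_div_x[OF Fc(4)] c\<phi>(1) z(1)])
  have i4: "integrable (lebesgue_on ?S) (\<lambda>p. deriv E (u p) * g (fst p, snd p, u p) * \<phi> p)"
    using int[OF continuous_on_deriv_weighted[OF E g] c\<phi>(1) z(1)] by (simp add: deriv_weighted_def)
  \<comment> \<open>The part of the integrand contributed by \<open>F(t,x,0)\<close>.\<close>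
  define d where "d = (\<lambda>p. F (fst p, snd p, 0) \<bullet> test_grad \<phi> p + div_x F (fst p, snd p, 0) * \<phi> p)"
  have d: "integrable (lebesgue_on ?S) d" "(LINT p|lebesgue_on ?S. d p) = 0"
    unfolding d_def by (rule integral_div_test_function_eq_0[OF I C1 \<phi>])+
  have i5: "integrable (lebesgue_on ?S) (\<lambda>p. production_density f g E (p, u p) \<bullet> test_jet I \<phi> p)"
    by (rule integrable_pairing_Linf[OF S K(1,2) continuous_on_production_density[OF I f g E] u c\<phi>(4) z(4)])
  have "entropy_production I f g u\<^sub>o u E \<phi> =
        (LINT p|lebesgue_on ?S. E (u p) * test_dt I \<phi> p + F (fst p, snd p, u p) \<bullet> test_grad \<phi> p)
      - (LINT p|lebesgue_on ?S. deriv E (u p) * div_x f (fst p, snd p, u p) * \<phi> p)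
      + (LINT p|lebesgue_on ?S. div_x F (fst p, snd p, u p) * \<phi> p)
      + (LINT p|lebesgue_on ?S. deriv E (u p) * g (fst p, snd p, u p) * \<phi> p)
      + (LINT x|lebesgue. E (u\<^sub>o x) * \<phi> (0, x))"
    using \<phi> by (simp add: entropy_production_def Let_def case_prod_beta' flip: F_def)
  also have "\<dots> = (LINT p|lebesgue_on ?S.
        (E (u p) * test_dt I \<phi> p + F (fst p, snd p, u p) \<bullet> test_grad \<phi> p)
        - deriv E (u p) * div_x f (fst p, snd p, u p) * \<phi> p
        + div_x F (fst p, snd p, u p) * \<phi> p + deriv E (u p) * g (fst p, snd p, u p) * \<phi> p)
      + (LINT x|lebesgue. E (u\<^sub>o x) * \<phi> (0, x))"
    using i1 i2 i3 i4 by simp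
  also have "(LINT p|lebesgue_on ?S.
        (E (u p) * test_dt I \<phi> p + F (fst p, snd p, u p) \<bullet> test_grad \<phi> p)
        - deriv E (u p) * div_x f (fst p, snd p, u p) * \<phi> p
        + div_x F (fst p, snd p, u p) * \<phi> p + deriv E (u p) * g (fst p, snd p, u p) * \<phi> p)
      = (LINT p|lebesgue_on ?S. production_density f g E (p, u p) \<bullet> test_jet I \<phi> p + d p)"
  proof (rule Bochner_Integration.integral_cong[OF refl])
    fix p assume "p \<in> space (lebesgue_on ?S)"
    then have t: "fst p \<in> closure I" using time_interval_facts(5)[OF I] by auto
    note eqs = entropy_flux_unique[OF I f E F t, of "snd p" "u p"]
    show "(E (u p) * test_dt I \<phi> p + F (fst p, snd p, u p) \<bullet> test_grad \<phi> p)
        - deriv E (u p) * div_x f (fst p, snd p, u p) * \<phi> p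
        + div_x F (fst p, snd p, u p) * \<phi> p + deriv E (u p) * g (fst p, snd p, u p) * \<phi> p
      = production_density f g E (p, u p) \<bullet> test_jet I \<phi> p + d p"
      unfolding eqs
      by (simp add: production_density_def test_jet_def d_def deriv_weighted_def algebra_simps)
  qed
  also have "\<dots> = (LINT p|lebesgue_on ?S. production_density f g E (p, u p) \<bullet> test_jet I \<phi> p)"
    using i5 d by simp
  finally show ?thesis .
qed

section \<open>Entropy production is a distribution\<close>

text \<open>
The trace at \<open>t = 0\<close> is supported in the projection \<open>snd ` K\<close>, which contains the slice of \<open>K\<close> at
\<open>t = 0\<close> and is compact. Thus the initial term is again a pairing with a compactly supported
function, now on \<open>\<real>\<^sup>n\<close>.
\<close>

lemma initial_trace:
  fixes \<phi> :: "real \<times> (real^'n) \<Rightarrow> real"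
  assumes I: "time_interval I" and \<phi>: "\<phi> \<in> test_functions I"
    and K: "compact K" "support_on (I \<times> UNIV) \<phi> \<subseteq> K"
  shows "continuous_on UNIV (\<lambda>x. \<phi> (0, x))" "compact (snd ` K)"
    "\<And>x. x \<in> UNIV - snd ` K \<Longrightarrow> \<phi> (0, x) = 0"
proof -
  note 0 = time_interval_facts(1)[OF I]
  show "continuous_on UNIV (\<lambda>x. \<phi> (0, x))"
    by (rule continuous_on_compose2[OF test_function_continuous(1)[OF I \<phi>]])
      (use 0 in \<open>auto intro!: continuous_intros\<close>)
  show "compact (snd ` K)"
    by (intro compact_continuous_image K continuous_intros)
  show "\<phi> (0, x) = 0" if "x \<in> UNIV - snd ` K" for x
    using test_function_zero(1)[OF I \<phi> K, of "(0, x)"] that 0 by force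
qed

lemma continuous_on_snd_compose:
  fixes E :: "real \<Rightarrow> real"
  assumes "E C1_differentiable_on UNIV"
  shows "continuous_on S (\<lambda>q. E (snd q))"
  by (rule continuous_on_compose2[OF C1_differentiable_onD(2)[OF assms]])
    (auto intro!: continuous_intros)

text \<open>
On test functions supported in \<open>K\<close> both integrals are bounded by the supremum of the first order
jet, so the distribution has order at most one.
\<close>

lemma entropy_production_in_distributions:
  fixes f :: "real \<times> (real^'n) \<times> real \<Rightarrow> real^'n"
  assumes I: "time_interval I" and f: "f \<in> flux_space I"
    and g: "continuous_on (closure I \<times> UNIV) g" and E: "E C1_differentiable_on UNIV"
    and u: "u \<in> Linf_on (I \<times> UNIV)" and u0: "u\<^sub>o \<in> Linf_on UNIV"
  shows "entropy_production I f g u\<^sub>o u E \<in> distributions I"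
proof -
  let ?S = "I \<times> (UNIV :: (real^'n) set)"
  define T where "T = entropy_production I f g u\<^sub>o u E"
  define A where "A = (\<lambda>\<phi>. LINT p|lebesgue_on ?S. production_density f g E (p, u p) \<bullet> test_jet I \<phi> p)"
  define A0 where "A0 = (\<lambda>\<phi> :: real \<times> (real^'n) \<Rightarrow> real. LINT x|lebesgue. E (u\<^sub>o x) * \<phi> (0, x))"
  have T: "T \<phi> = A \<phi> + A0 \<phi>" if "\<phi> \<in> test_functions I" for \<phi>
    unfolding T_def A_def A0_def by (rule entropy_production_eq[OF I f g E u that])
  note S = time_space_borel[OF I, where 'n = 'n]
  note H = continuous_on_production_density[OF I f g E]
  have iA: "integrable (lebesgue_on ?S) (\<lambda>p. production_density f g E (p, u p) \<bullet> test_jet I \<phi> p)"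
      and iA0: "integrable lebesgue (\<lambda>x. E (u\<^sub>o x) * \<phi> (0, x))" if \<phi>: "\<phi> \<in> test_functions I" for \<phi>
  proof -
    obtain K where K: "compact K" "K \<subseteq> ?S" "support_on ?S \<phi> \<subseteq> K"
      using \<phi> by (rule test_function_support)
    show "integrable (lebesgue_on ?S) (\<lambda>p. production_density f g E (p, u p) \<bullet> test_jet I \<phi> p)"
      by (rule integrable_pairing_Linf[OF S K(1,2) H u test_function_continuous(4)[OF I \<phi>]
            test_function_zero(4)[OF I \<phi> K(1,3)]])
    note tr = initial_trace[OF I \<phi> K(1,3)]
    show "integrable lebesgue (\<lambda>x. E (u\<^sub>o x) * \<phi> (0, x))"
      using integrable_pairing_Linf[OF _ tr(2) subset_UNIV continuous_on_snd_compose[OF E] u0 tr(1,3)]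
      by (simp add: lebesgue_on_UNIV_eq)
  qed
  have lin: "T (\<lambda>p. c * \<phi> p + d * \<psi> p) = c * T \<phi> + d * T \<psi>"
    if \<phi>: "\<phi> \<in> test_functions I" and \<psi>: "\<psi> \<in> test_functions I" for c d \<phi> \<psi>
  proof -
    note l = test_functions_lincomb[OF I \<phi> \<psi>, where c = c and d = d]
    have "A (\<lambda>p. c * \<phi> p + d * \<psi> p) = (LINT p|lebesgue_on ?S.
        c * (production_density f g E (p, u p) \<bullet> test_jet I \<phi> p)
        + d * (production_density f g E (p, u p) \<bullet> test_jet I \<psi> p))"
      unfolding A_def
      by (rule Bochner_Integration.integral_cong[OF refl]) (simp add: l(2) inner_add_right)
    then have "A (\<lambda>p. c * \<phi> p + d * \<psi> p) = c * A \<phi> + d * A \<psi>"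
      using iA[OF \<phi>] iA[OF \<psi>] by (simp add: A_def)
    moreover have "A0 (\<lambda>p. c * \<phi> p + d * \<psi> p) = c * A0 \<phi> + d * A0 \<psi>"
    proof -
      have "A0 (\<lambda>p. c * \<phi> p + d * \<psi> p)
          = (LINT x|lebesgue. c * (E (u\<^sub>o x) * \<phi> (0, x)) + d * (E (u\<^sub>o x) * \<psi> (0, x)))"
        by (simp add: A0_def algebra_simps)
      then show ?thesis using iA0[OF \<phi>] iA0[OF \<psi>] by (simp add: A0_def)
    qed
    ultimately show ?thesis
      using T[OF l(1)] T[OF \<phi>] T[OF \<psi>] by (simp add: algebra_simps)
  qed
  have bound: "\<exists>C m. \<forall>\<phi>\<in>test_functions I. support_on ?S \<phi> \<subseteq> K \<longrightarrow> \<bar>T \<phi>\<bar> \<le> C * Cm_norm_on I K m \<phi>"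
    if K: "compact K" "K \<subseteq> ?S" for K
  proof -
    from integral_pairing_bounded[OF S K H u]
    obtain B where B: "\<And>\<psi> M. continuous_on ?S \<psi> \<Longrightarrow> (\<forall>p\<in>?S - K. \<psi> p = 0) \<Longrightarrow> 0 \<le> M \<Longrightarrow>
        (\<forall>p\<in>K. norm (\<psi> p) \<le> M) \<Longrightarrow>
        \<bar>LINT p|lebesgue_on ?S. production_density f g E (p, u p) \<bullet> \<psi> p\<bar> \<le> B * M"
      by blast
    have "compact (snd ` K)" by (intro compact_continuous_image K continuous_intros)
    from integral_pairing_bounded[OF borel_open[OF open_UNIV] this subset_UNIV continuous_on_snd_compose[OF E] u0,
        unfolded lebesgue_on_UNIV_eq inner_real_def snd_conv]
    obtain B0 where B0: "\<And>\<psi> M. continuous_on UNIV \<psi> \<Longrightarrow> (\<forall>x\<in>UNIV - snd ` K. \<psi> x = 0) \<Longrightarrow> 0 \<le> M \<Longrightarrow>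
        (\<forall>x\<in>snd ` K. norm (\<psi> x) \<le> M) \<Longrightarrow> \<bar>LINT x|lebesgue. E (u\<^sub>o x) * \<psi> x\<bar> \<le> B0 * M"
      by blast
    have "\<bar>T \<phi>\<bar> \<le> (B * (2 + CARD('n)) + B0) * Cm_norm_on I K 1 \<phi>"
      if \<phi>: "\<phi> \<in> test_functions I" and supp: "support_on ?S \<phi> \<subseteq> K" for \<phi>
    proof -
      note n = norm_test_jet_le[OF I \<phi> K]
      note tr = initial_trace[OF I \<phi> K(1) supp]
      have "\<bar>A \<phi>\<bar> \<le> B * ((2 + CARD('n)) * Cm_norm_on I K 1 \<phi>)"
        unfolding A_def
        by (rule B) (use test_function_continuous(4)[OF I \<phi>] test_function_zero(4)[OF I \<phi> K(1) supp] n in auto)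
      moreover have "\<bar>\<phi> (0, x)\<bar> \<le> Cm_norm_on I K 1 \<phi>" for x
      proof (cases "(0, x) \<in> K")
        case False
        then show ?thesis
          using test_function_zero(1)[OF I \<phi> K(1) supp, of "(0, x)"] time_interval_facts(1)[OF I] n(1)
          by auto
      qed (rule n(2))
      then have "\<bar>A0 \<phi>\<bar> \<le> B0 * Cm_norm_on I K 1 \<phi>"
        unfolding A0_def by (intro B0 tr(1) n(1)) (use tr(3) in auto)
      ultimately show ?thesis
        unfolding T[OF \<phi>] by (simp add: algebra_simps)
    qed
    then show ?thesis by blast
  qed
  have "T \<in> extensional (test_functions I)"
    by (simp add: T_def entropy_production_def Let_def)
  moreover have "T (\<lambda>p. \<phi> p + \<psi> p) = T \<phi> + T \<psi>" if "\<phi> \<in> test_functions I" "\<psi> \<in> test_functions I" for \<phi> \<psi>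
    using lin[OF that, of 1 1] by simp
  moreover have "T (\<lambda>p. c * \<phi> p) = c * T \<phi>" if "\<phi> \<in> test_functions I" for c \<phi>
    using lin[OF that that, of c 0] by simp
  ultimately show ?thesis
    using bound unfolding distributions_def T_def[symmetric] by blast
qed

section \<open>Passage to the limit\<close>

lemma AE_compact_lebesgue_on:
  assumes S: "S \<in> sets borel" and K: "compact K" "K \<subseteq> S"
    and ae: "AE p in lebesgue_on K. P p"
  shows "AE p in lebesgue_on S. p \<in> K \<longrightarrow> P p"
proof -
  have "K \<in> sets lebesgue" using lmeasurable_compact[OF K(1)] by (rule fmeasurableD)
  then have "AE p in lebesgue. p \<in> K \<longrightarrow> P p"
    using ae by (subst (asm) AE_restrict_space_iff) auto
  then have "AE p in lebesgue. p \<in> S \<longrightarrow> p \<in> K \<longrightarrow> P p" by auto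
  then show ?thesis using S by (subst AE_restrict_space_iff) auto
qed

text \<open>
The density is built from \<open>E\<close>, \<open>E'\<close>, \<open>g\<close>, \<open>div f\<close> and the primitives in \<open>u\<close> of \<open>E' \<partial>\<^sub>uf\<close> and \<open>E' \<nabla>\<^sub>x\<partial>\<^sub>uf\<close>.
All of these ingredients converge uniformly on cylinders, and the limits are bounded there, so
that products converge as well.
\<close>

lemma uniform_limit_production_density:
  fixes f :: "real \<times> (real^'n) \<times> real \<Rightarrow> real^'n"
  assumes I: "time_interval I" and f: "f \<in> flux_space I" "\<And>n. fs n \<in> flux_space I"
    and g: "continuous_on (closure I \<times> UNIV) g"
    and E: "E C1_differentiable_on UNIV" "\<And>n. Es n C1_differentiable_on UNIV"
    and K: "compact K" "K \<subseteq> I \<times> UNIV"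
    and f_conv: "(\<lambda>n. flux_seminorm I (cylinder K C) (\<lambda>p. fs n p - f p)) \<longlonglongrightarrow> 0"
    and g_conv: "uniform_limit (cylinder K C) gs g sequentially"
    and E_conv: "C1_converges Es E"
  shows "uniform_limit (K \<times> {-C..C}) (\<lambda>n. production_density (fs n) (gs n) (Es n))
    (production_density f g E) sequentially"
proof -
  let ?L = "cylinder K C"
  have KJ: "K \<subseteq> closure I \<times> UNIV" using K(2) time_interval_facts(5)[OF I] by auto
  have L: "compact ?L" "?L \<subseteq> closure I \<times> UNIV"
    using compact_cylinder[OF K(1)] KJ by (auto simp: in_cylinder_iff)
  have El: "uniform_limit {-C..C} Es E sequentially"
      "uniform_limit {-C..C} (\<lambda>n. deriv (Es n)) (deriv E) sequentially"
    using E_conv by (auto simp: C1_converges_def)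
  note fl = flux_seminorm_uniform_limits[OF I f L f_conv]
  note fc = flux_space_continuous[OF I f(1)] and fsc = flux_space_continuous[OF I f(2)]
  note cs = uniform_limit_deriv_weighted[OF El(2) E(1) _ _ K(1)]
  have G: "uniform_limit ?L (\<lambda>n. normalised_flux (fs n) (Es n)) (normalised_flux f E) sequentially"
    unfolding normalised_flux_def
    by (rule uniform_limit_u_primitive[OF cs[OF fl(1) continuous_on_subset[OF fc(3) L(2)]] KJ
          continuous_on_deriv_weighted[OF E(1) fc(3)] continuous_on_deriv_weighted[OF E(2) fsc(3)]])
  have "uniform_limit ?L (\<lambda>n. u_primitive (deriv_weighted (Es n) (grad_x (pd_u (fs n)))))
      (u_primitive (deriv_weighted E (grad_x (pd_u f)))) sequentially"
    by (rule uniform_limit_u_primitive[OF cs[OF fl(3) continuous_on_subset[OF fc(6) L(2)]] KJ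
          continuous_on_deriv_weighted[OF E(1) fc(6)] continuous_on_deriv_weighted[OF E(2) fsc(6)]])
  then have "uniform_limit ?L (\<lambda>n. grad_x (normalised_flux (fs n) (Es n)))
      (grad_x (normalised_flux f E)) sequentially"
  proof (rule uniform_limit_cong'[THEN iffD1, rotated -1])
    fix n p assume "p \<in> ?L"
    then obtain t x u where "p = (t, x, u)" "t \<in> closure I" using L(2) by (cases p rule: prod_cases3) auto
    then show "u_primitive (deriv_weighted (Es n) (grad_x (pd_u (fs n)))) p = grad_x (normalised_flux (fs n) (Es n)) p"
      by (simp add: grad_x_normalised[OF I f(2) E(2)])
  next
    fix p assume "p \<in> ?L"
    then obtain t x u where "p = (t, x, u)" "t \<in> closure I" using L(2) by (cases p rule: prod_cases3) auto
    then show "u_primitive (deriv_weighted E (grad_x (pd_u f))) p = grad_x (normalised_flux f E) p"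
      by (simp add: grad_x_normalised[OF I f(1) E(1)])
  qed
  then have divG: "uniform_limit ?L (\<lambda>n. div_x (normalised_flux (fs n) (Es n)))
      (div_x (normalised_flux f E)) sequentially"
    by (rule uniform_limit_div_x)
  have "uniform_limit ?L (\<lambda>n. deriv_weighted (Es n) (\<lambda>q. gs n q - div_x (fs n) q))
      (deriv_weighted E (\<lambda>q. g q - div_x f q)) sequentially"
    by (intro cs uniform_limit_minus g_conv uniform_limit_div_x[OF fl(2)] continuous_on_diff
        continuous_on_subset[OF g L(2)] continuous_on_subset[OF continuous_on_div_x[OF fc(4)] L(2)])
  from uniform_limit_Pair[OF G uniform_limit_add[OF this divG]]
  have src: "uniform_limit ?L
      (\<lambda>n q. (normalised_flux (fs n) (Es n) q,
         deriv_weighted (Es n) (\<lambda>q. gs n q - div_x (fs n) q) q + div_x (normalised_flux (fs n) (Es n)) q))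
      (\<lambda>q. (normalised_flux f E q, deriv_weighted E (\<lambda>q. g q - div_x f q) q + div_x (normalised_flux f E) q))
      sequentially" .
  have 1: "uniform_limit (K \<times> {-C..C}) (\<lambda>n q. Es n (snd q)) (\<lambda>q. E (snd q)) sequentially"
    by (rule uniform_limit_compose'[OF El(1)]) auto
  have 2: "(\<lambda>q. (fst (fst q), snd (fst q), snd q)) \<in> K \<times> {-C..C} \<rightarrow> ?L"
    by (auto simp: in_cylinder_iff abs_le_iff)
  from uniform_limit_Pair[OF 1 uniform_limit_compose'[OF src 2]]
  show ?thesis by (simp add: production_density_def[abs_def] case_prod_beta')
qed

lemma entropy_production_tendsto:
  fixes f :: "real \<times> (real^'n) \<times> real \<Rightarrow> real^'n"
  assumes I: "time_interval I"
    and f: "f \<in> flux_space I" "\<And>n. fs n \<in> flux_space I"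
    and g: "continuous_on (closure I \<times> UNIV) g" "\<And>n. continuous_on (closure I \<times> UNIV) (gs n)"
    and u0: "u\<^sub>o \<in> Linf_on UNIV" "\<And>n. u0s n \<in> Linf_on UNIV"
    and u: "u \<in> Linf_on (I \<times> UNIV)" "\<And>n. us n \<in> Linf_on (I \<times> UNIV)"
    and E: "E C1_differentiable_on UNIV" "\<And>n. Es n C1_differentiable_on UNIV"
    and f_conv: "\<And>L. compact L \<Longrightarrow> L \<subseteq> I \<times> UNIV \<Longrightarrow>
      (\<lambda>n. flux_seminorm I L (\<lambda>p. fs n p - f p)) \<longlonglongrightarrow> 0"
    and g_conv: "\<And>L. compact L \<Longrightarrow> L \<subseteq> I \<times> UNIV \<Longrightarrow> uniform_limit L gs g sequentially"
    and u0_conv: "AE x in lebesgue. (\<lambda>n. u0s n x) \<longlonglongrightarrow> u\<^sub>o x"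
    and u0_bdd: "bounded_Linf_loc UNIV u0s"
    and u_conv: "AE p in lebesgue_on (I \<times> UNIV). (\<lambda>n. us n p) \<longlonglongrightarrow> u p"
    and u_bdd: "bounded_Linf_loc (I \<times> UNIV) us"
    and E_conv: "C1_converges Es E"
    and \<phi>: "\<phi> \<in> test_functions I"
  shows "(\<lambda>n. entropy_production I (fs n) (gs n) (u0s n) (us n) (Es n) \<phi>)
    \<longlonglongrightarrow> entropy_production I f g u\<^sub>o u E \<phi>"
proof -
  let ?S = "I \<times> (UNIV :: (real^'n) set)"
  note S = time_space_borel[OF I, where 'n = 'n]
  obtain K where K: "compact K" "K \<subseteq> ?S" "support_on ?S \<phi> \<subseteq> K"
    using \<phi> by (rule test_function_support)
  obtain C where C: "\<And>n. AE p in lebesgue_on K. \<bar>us n p\<bar> \<le> C"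
    using u_bdd K(1,2) unfolding bounded_Linf_loc_def by blast
  have um: "w \<in> borel_measurable (lebesgue_on T)" if "w \<in> Linf_on T" for w :: "'z::euclidean_space \<Rightarrow> real" and T
    using that by (simp add: Linf_on_def)
  have cyl: "cylinder K C \<subseteq> I \<times> UNIV" for C
    using K(2) by (auto simp: in_cylinder_iff)
  have "(\<lambda>n. LINT p|lebesgue_on ?S. production_density (fs n) (gs n) (Es n) (p, us n p) \<bullet> test_jet I \<phi> p)
      \<longlonglongrightarrow> (LINT p|lebesgue_on ?S. production_density f g E (p, u p) \<bullet> test_jet I \<phi> p)"
    by (rule tendsto_pairing[OF S K(1,2) continuous_on_production_density[OF I f(1) g(1) E(1)]
          continuous_on_production_density[OF I f(2) g(2) E(2)] um[OF u(1)] um[OF u(2)]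
          test_function_continuous(4)[OF I \<phi>] test_function_zero(4)[OF I \<phi> K(1,3)]
          AE_compact_lebesgue_on[OF S K(1,2) C] u_conv
          uniform_limit_production_density[OF I f g(1) E K(1,2)
            f_conv[OF compact_cylinder[OF K(1)] cyl] g_conv[OF compact_cylinder[OF K(1)] cyl] E_conv]])
  moreover have "(\<lambda>n. LINT x|lebesgue. Es n (u0s n x) * \<phi> (0, x))
      \<longlonglongrightarrow> (LINT x|lebesgue. E (u\<^sub>o x) * \<phi> (0, x))"
  proof -
    note tr = initial_trace[OF I \<phi> K(1,3)]
    obtain C0 where C0: "\<And>n. AE x in lebesgue_on (snd ` K). \<bar>u0s n x\<bar> \<le> C0"
      using u0_bdd tr(2) unfolding bounded_Linf_loc_def by blast
    have El: "uniform_limit (snd ` K \<times> {-C..C}) (\<lambda>n q. Es n (snd q)) (\<lambda>q. E (snd q)) sequentially" for C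
    proof (rule uniform_limit_compose')
      show "uniform_limit {-C..C} Es E sequentially" using E_conv by (simp add: C1_converges_def)
    qed auto
    have ae: "AE x in lebesgue_on UNIV. (\<lambda>n. u0s n x) \<longlonglongrightarrow> u\<^sub>o x"
      unfolding lebesgue_on_UNIV_eq by (rule u0_conv)
    show ?thesis
      using tendsto_pairing[OF _ tr(2) subset_UNIV continuous_on_snd_compose[OF E(1)]
          continuous_on_snd_compose[OF E(2)] um[OF u0(1)] um[OF u0(2)] tr(1,3)
          AE_compact_lebesgue_on[OF _ tr(2) subset_UNIV C0] ae El]
      by (simp add: lebesgue_on_UNIV_eq)
  qed
  ultimately show ?thesis
    unfolding entropy_production_eq[OF I f(1) g(1) E(1) u(1) \<phi>]
      entropy_production_eq[OF I f(2) g(2) E(2) u(2) \<phi>]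
    by (rule tendsto_add)
qed

section \<open>Stability of the entropy production\<close>

theorem theorem2p6:
  fixes I :: "real set"
    and f :: "real \<times> (real^'n) \<times> real \<Rightarrow> real^'n"
    and f\<^sub>\<nu> :: "nat \<Rightarrow> real \<times> (real^'n) \<times> real \<Rightarrow> real^'n"
    and g :: "real \<times> (real^'n) \<times> real \<Rightarrow> real"
    and g\<^sub>\<nu> :: "nat \<Rightarrow> real \<times> (real^'n) \<times> real \<Rightarrow> real"
    and u\<^sub>o :: "real^'n \<Rightarrow> real"
    and u\<^sub>o\<^sub>\<nu> :: "nat \<Rightarrow> real^'n \<Rightarrow> real"
    and u_inf :: "real \<times> (real^'n) \<Rightarrow> real"
    and u\<^sub>\<nu> :: "nat \<Rightarrow> real \<times> (real^'n) \<Rightarrow> real"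
    and E :: "real \<Rightarrow> real"
    and E\<^sub>\<nu> :: "nat \<Rightarrow> real \<Rightarrow> real"
  assumes I: "time_interval I"
    and f: "f \<in> flux_space I" "\<And>\<nu>. f\<^sub>\<nu> \<nu> \<in> flux_space I"
    and g: "continuous_on (closure I \<times> UNIV \<times> UNIV) g"
      "\<And>\<nu>. continuous_on (closure I \<times> UNIV \<times> UNIV) (g\<^sub>\<nu> \<nu>)"
    and u_init: "u\<^sub>o \<in> Linf_on UNIV" "\<And>\<nu>. u\<^sub>o\<^sub>\<nu> \<nu> \<in> Linf_on UNIV"
    and u: "u_inf \<in> Linf_on (I \<times> UNIV)" "\<And>\<nu>. u\<^sub>\<nu> \<nu> \<in> Linf_on (I \<times> UNIV)"
    and E: "E C1_differentiable_on UNIV" "\<And>\<nu>. E\<^sub>\<nu> \<nu> C1_differentiable_on UNIV"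
    and f_conv: "\<And>K. compact K \<Longrightarrow> K \<subseteq> I \<times> UNIV \<times> UNIV \<Longrightarrow>
      (\<lambda>\<nu>. flux_seminorm I K (\<lambda>p. f\<^sub>\<nu> \<nu> p - f p)) \<longlonglongrightarrow> 0"
    and g_conv: "\<And>K. compact K \<Longrightarrow> K \<subseteq> I \<times> UNIV \<times> UNIV \<Longrightarrow>
      uniform_limit K g\<^sub>\<nu> g sequentially"
    and u_init_conv: "AE x in lebesgue. (\<lambda>\<nu>. u\<^sub>o\<^sub>\<nu> \<nu> x) \<longlonglongrightarrow> u\<^sub>o x"
    and u_init_bdd: "bounded_Linf_loc UNIV u\<^sub>o\<^sub>\<nu>"
    and u_conv: "AE p in lebesgue_on (I \<times> UNIV). (\<lambda>\<nu>. u\<^sub>\<nu> \<nu> p) \<longlonglongrightarrow> u_inf p"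
    and u_bdd: "bounded_Linf_loc (I \<times> UNIV) u\<^sub>\<nu>"
    and E_conv: "C1_converges E\<^sub>\<nu> E"
  shows "limitin (weak_star_topology I)
    (\<lambda>\<nu>. entropy_production I (f\<^sub>\<nu> \<nu>) (g\<^sub>\<nu> \<nu>) (u\<^sub>o\<^sub>\<nu> \<nu>) (u\<^sub>\<nu> \<nu>) (E\<^sub>\<nu> \<nu>))
    (entropy_production I f g u\<^sub>o u_inf E) sequentially"
proof -
  note f_conv' = f_conv[unfolded UNIV_Times_UNIV] and g_conv' = g_conv[unfolded UNIV_Times_UNIV]
    and g' = g[unfolded UNIV_Times_UNIV]
  show ?thesis
    unfolding limitin_weak_star
  proof (intro conjI ballI always_eventually allI)
    show "entropy_production I f g u\<^sub>o u_inf E \<in> distributions I"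
      by (rule entropy_production_in_distributions[OF I f(1) g'(1) E(1) u(1) u_init(1)])
    show "entropy_production I (f\<^sub>\<nu> \<nu>) (g\<^sub>\<nu> \<nu>) (u\<^sub>o\<^sub>\<nu> \<nu>) (u\<^sub>\<nu> \<nu>) (E\<^sub>\<nu> \<nu>) \<in> distributions I" for \<nu>
      by (rule entropy_production_in_distributions[OF I f(2) g'(2) E(2) u(2) u_init(2)])
    show "(\<lambda>\<nu>. entropy_production I (f\<^sub>\<nu> \<nu>) (g\<^sub>\<nu> \<nu>) (u\<^sub>o\<^sub>\<nu> \<nu>) (u\<^sub>\<nu> \<nu>) (E\<^sub>\<nu> \<nu>) \<phi>)
        \<longlonglongrightarrow> entropy_production I f g u\<^sub>o u_inf E \<phi>" if "\<phi> \<in> test_functions I" for \<phi>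
      by (rule entropy_production_tendsto[OF I f g' u_init u E f_conv' g_conv' u_init_conv u_init_bdd
            u_conv u_bdd E_conv that])
  qed
qed

end
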